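(* Let $\mathbf{k}$ be a unitary commutative ring and let $R=\mathbf{k}((t))=\mathbf{k}[[t]]\oplus t^{-1}\mathbf{k}[t^{-1}]$ be the ring of Laurent series with the Rota-Baxter operator $P$ (of weight $-1$) being the projection to the pole part $t^{-1}\mathbf{k}[t^{-1}]$ along $\mathbf{k}[[t]]$. Then in the realization $U_{RB}(R)=R\oplus(R\otimes_{\mathbf{k}}R)$ the product of elements of $R\otimes_{\mathbf{k}} R$ is given by $$(t^i\otimes t^j)\cdot(t^k\otimes t^\ell)=\begin{cases}t^{i+j+k}\otimes t^\ell, & j+k<0,\\ t^i\otimes t^{j+k+\ell}, & j+k\ge 0,\end{cases}$$ for integers $i,j,k,\ell$. More generally, for $\mathfrak{a}=\sum_{i\ge N}a_it^i$, $\mathfrak{b}=\sum_{j\ge N}b_jt^j$, $\mathfrak{c}=\sum_{k\ge N}c_kt^k$ and $\mathfrak{d}=\sum_{\ell\ge N}d_\ell t^\ell$ in $\mathbf{k}((t))$, $$(\mathfrak{a}\otimes\mathfrak{b})\cdot(\mathfrak{c}\otimes\mathfrak{d})=\Big(\mathfrak{a}\sum_{j,k\ge N,\ j+k<0}b_jc_kt^{j+k}\Big)\otimes\mathfrak{d}+\mathfrak{a}\otimes\Big(\sum_{j,k\ge N,\ j+k\ge 0}b_jc_kt^{j+k}\,\mathfrak{d}\Big).$$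
   Context: A Rota-Baxter algebra of weight $\lambda\in\mathbf{k}$ is a pair $(R,P)$ with $R$ a unitary associative $\mathbf{k}$-algebra and $P:R\to R$ $\mathbf{k}$-linear with $P(x)P(y)=P(xP(y))+P(P(x)y)+\lambda P(xy)$ for all $x,y\in R$. The ring of Rota-Baxter operators $U_{RB}(R)$ is the quotient of the free product of the $\mathbf{k}$-algebras $R$ and $\mathbf{k}[Q]$ by the two-sided ideal generated by all $QrQ-P(r)Q+QP(r)+\lambda Qr$, $r\in R$. With $\tilde P=-\lambda\,\mathrm{id}_R-P$, it is identified as an algebra with $R\oplus(R\otimes_{\mathbf{k}}R)$ (where $r\in R$ corresponds to $r$ and $r\otimes s$ to $rQs$), whose product on $R\otimes_{\mathbf{k}} R$ is $(r_1\otimes s_1)\cdot(r_2\otimes s_2)=r_1P(s_1r_2)\otimes s_2+r_1\otimes\tilde P(s_1r_2)s_2$, with $R$ acting on $R\otimes_{\mathbf{k}} R$ by left multiplication on the first factor and right multiplication on the second. *)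

theory Defs
  imports
    "HOL-Computational_Algebra.Formal_Laurent_Series"
    "HOL-Analysis.Infinite_Sum"
    "HOL-Algebra.Free_Abelian_Groups"
    "HOL-Algebra.QuotRing"
begin


section \<open>Rota-Baxter algebras\<close>

locale k_algebra = Modules.module smul
  for smul :: "'k::comm_ring_1 \<Rightarrow> 'r::ring_1 \<Rightarrow> 'r" +
  assumes scale_mult_left: "smul c x * y = smul c (x * y)"
    and scale_mult_right: "x * smul c y = smul c (x * y)"

locale rota_baxter_algebra = k_algebra smul
  for smul :: "'k::comm_ring_1 \<Rightarrow> 'r::ring_1 \<Rightarrow> 'r" +
  fixes P :: "'r \<Rightarrow> 'r" and lam :: 'k
  assumes P_linear: "module_hom smul smul P"
    and rota_baxter: "P x * P y = P (x * P y) + P (P x * y) + smul lam (P (x * y))"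

definition P_tilde :: "('k \<Rightarrow> 'r::ring_1 \<Rightarrow> 'r) \<Rightarrow> ('r \<Rightarrow> 'r) \<Rightarrow> 'k \<Rightarrow> 'r \<Rightarrow> 'r" where
  "P_tilde smul P lam x = - smul lam x - P x"


section \<open>The tensor product over the base ring\<close>

text \<open>The tensor product of a module with itself over the base ring: the free abelian group on
  pairs modulo the subgroup generated by the relations of a balanced biadditive map. Its elements
  are cosets of that subgroup.\<close>

definition tensor_relations ::
  "('k \<Rightarrow> 'r::ab_group_add \<Rightarrow> 'r) \<Rightarrow> ('r \<times> 'r \<Rightarrow>\<^sub>0 int) set" where
  "tensor_relations smul =
     {frag_of (x + y, z) - frag_of (x, z) - frag_of (y, z) | x y z. True} \<union>
     {frag_of (x, y + z) - frag_of (x, y) - frag_of (x, z) | x y z. True} \<union>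
     {frag_of (smul c x, y) - frag_of (x, smul c y) | c x y. True}"

definition tensor_null :: "('k \<Rightarrow> 'r::ab_group_add \<Rightarrow> 'r) \<Rightarrow> ('r \<times> 'r \<Rightarrow>\<^sub>0 int) set" where
  "tensor_null smul =
     generate (free_Abelian_group UNIV) (tensor_relations smul)"

definition tensor_group :: "('k \<Rightarrow> 'r::ab_group_add \<Rightarrow> 'r) \<Rightarrow> ('r \<times> 'r \<Rightarrow>\<^sub>0 int) set monoid" where
  "tensor_group smul =
     free_Abelian_group UNIV Mod tensor_null smul"

definition tensor_class ::
  "('k \<Rightarrow> 'r::ab_group_add \<Rightarrow> 'r) \<Rightarrow> ('r \<times> 'r \<Rightarrow>\<^sub>0 int) \<Rightarrow> ('r \<times> 'r \<Rightarrow>\<^sub>0 int) set" where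
  "tensor_class smul f =
     tensor_null smul #>\<^bsub>free_Abelian_group UNIV\<^esub> f"

definition pure_tensor :: "('k \<Rightarrow> 'r::ab_group_add \<Rightarrow> 'r) \<Rightarrow> 'r \<Rightarrow> 'r \<Rightarrow> ('r \<times> 'r \<Rightarrow>\<^sub>0 int) set" where
  "pure_tensor smul x y = tensor_class smul (frag_of (x, y))"


section \<open>The algebra on the direct sum of the ring and its tensor square\<close>

text \<open>The two actions and the product are first given on formal sums of pairs. The union over all
  representatives is a single class, because the operations respect
  \<^const>\<open>tensor_null\<close> (shown below).\<close>

definition rep_lact :: "'r::ring_1 \<Rightarrow> ('r \<times> 'r \<Rightarrow>\<^sub>0 int) \<Rightarrow> ('r \<times> 'r \<Rightarrow>\<^sub>0 int)" where
  "rep_lact r f = frag_extend (\<lambda>(x, y). frag_of (r * x, y)) f"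

definition rep_ract :: "('r::ring_1 \<times> 'r \<Rightarrow>\<^sub>0 int) \<Rightarrow> 'r \<Rightarrow> ('r \<times> 'r \<Rightarrow>\<^sub>0 int)" where
  "rep_ract f s = frag_extend (\<lambda>(x, y). frag_of (x, y * s)) f"

definition rep_mult :: "('k \<Rightarrow> 'r::ring_1 \<Rightarrow> 'r) \<Rightarrow> ('r \<Rightarrow> 'r) \<Rightarrow> 'k \<Rightarrow>
    ('r \<times> 'r \<Rightarrow>\<^sub>0 int) \<Rightarrow> ('r \<times> 'r \<Rightarrow>\<^sub>0 int) \<Rightarrow> ('r \<times> 'r \<Rightarrow>\<^sub>0 int)" where
  "rep_mult smul P lam f g =
     frag_extend (\<lambda>(r1, s1). frag_extend (\<lambda>(r2, s2).
       frag_of (r1 * P (s1 * r2), s2) + frag_of (r1, P_tilde smul P lam (s1 * r2) * s2)) g) f"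

definition tensor_lact :: "('k \<Rightarrow> 'r::ring_1 \<Rightarrow> 'r) \<Rightarrow> 'r \<Rightarrow>
    ('r \<times> 'r \<Rightarrow>\<^sub>0 int) set \<Rightarrow> ('r \<times> 'r \<Rightarrow>\<^sub>0 int) set" where
  "tensor_lact smul r X = (\<Union>f\<in>X. tensor_class smul (rep_lact r f))"

definition tensor_ract :: "('k \<Rightarrow> 'r::ring_1 \<Rightarrow> 'r) \<Rightarrow>
    ('r \<times> 'r \<Rightarrow>\<^sub>0 int) set \<Rightarrow> 'r \<Rightarrow> ('r \<times> 'r \<Rightarrow>\<^sub>0 int) set" where
  "tensor_ract smul X s = (\<Union>f\<in>X. tensor_class smul (rep_ract f s))"

definition tensor_mult :: "('k \<Rightarrow> 'r::ring_1 \<Rightarrow> 'r) \<Rightarrow> ('r \<Rightarrow> 'r) \<Rightarrow> 'k \<Rightarrow>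
    ('r \<times> 'r \<Rightarrow>\<^sub>0 int) set \<Rightarrow> ('r \<times> 'r \<Rightarrow>\<^sub>0 int) set \<Rightarrow> ('r \<times> 'r \<Rightarrow>\<^sub>0 int) set" where
  "tensor_mult smul P lam X Y =
     (\<Union>f\<in>X. \<Union>g\<in>Y. tensor_class smul (rep_mult smul P lam f g))"

definition rb_realization :: "('k \<Rightarrow> 'r::ring_1 \<Rightarrow> 'r) \<Rightarrow> ('r \<Rightarrow> 'r) \<Rightarrow> 'k \<Rightarrow>
    ('r \<times> ('r \<times> 'r \<Rightarrow>\<^sub>0 int) set) ring" where
  "rb_realization smul P lam =
     \<lparr>carrier = UNIV \<times> carrier (tensor_group smul),
      mult = (\<lambda>(r, X) (s, Y). (r * s,
        tensor_lact smul r Y \<otimes>\<^bsub>tensor_group smul\<^esub> tensor_ract smul X s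
          \<otimes>\<^bsub>tensor_group smul\<^esub> tensor_mult smul P lam X Y)),
      one = (1, \<one>\<^bsub>tensor_group smul\<^esub>),
      zero = (0, \<one>\<^bsub>tensor_group smul\<^esub>),
      add = (\<lambda>(r, X) (s, Y). (r + s, X \<otimes>\<^bsub>tensor_group smul\<^esub> Y))\<rparr>"

definition rb_scalar :: "('k \<Rightarrow> 'r::ring_1 \<Rightarrow> 'r) \<Rightarrow> 'r \<Rightarrow> 'r \<times> ('r \<times> 'r \<Rightarrow>\<^sub>0 int) set" where
  "rb_scalar smul r = (r, \<one>\<^bsub>tensor_group smul\<^esub>)"

definition rb_tensor :: "('k \<Rightarrow> 'r::ring_1 \<Rightarrow> 'r) \<Rightarrow> 'r \<Rightarrow> 'r \<Rightarrow> 'r \<times> ('r \<times> 'r \<Rightarrow>\<^sub>0 int) set" where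
  "rb_tensor smul r s = (0, pure_tensor smul r s)"


section \<open>The ring of Rota-Baxter operators\<close>

datatype 'a free_word = Word "'a list"

instantiation free_word :: (type) monoid_add
begin

fun plus_free_word :: "'a free_word \<Rightarrow> 'a free_word \<Rightarrow> 'a free_word" where
  "Word u + Word v = Word (u @ v)"

definition zero_free_word :: "'a free_word" where
  "0 = Word []"

instance
proof
  fix a b c :: "'a free_word"
  show "a + b + c = a + (b + c)"
    by (cases a; cases b; cases c) simp
  show "0 + a = a" "a + 0 = a"
    by (cases a; simp add: zero_free_word_def)+
qed

end

text \<open>With concatenation as addition of exponents, \<open>'a free_word \<Rightarrow>\<^sub>0 'k\<close> is the free associative
  algebra on \<open>'a\<close>.\<close>

definition free_gen :: "'a \<Rightarrow> 'a free_word \<Rightarrow>\<^sub>0 'k::comm_ring_1" where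
  "free_gen a = Poly_Mapping.single (Word [a]) 1"

definition free_const :: "'k::comm_ring_1 \<Rightarrow> 'a free_word \<Rightarrow>\<^sub>0 'k" where
  "free_const c = Poly_Mapping.single 0 c"

definition ring_of_type :: "'r::ring_1 ring" where
  "ring_of_type = \<lparr>carrier = UNIV, mult = (*), one = 1, zero = 0, add = (+)\<rparr>"

text \<open>The relations that make \<open>g\<close>, followed by the inclusion of generators, a homomorphism of unital
  algebras.\<close>

definition hom_relations :: "('k::comm_ring_1 \<Rightarrow> 'r::ring_1 \<Rightarrow> 'r) \<Rightarrow> ('r \<Rightarrow> 'g) \<Rightarrow> ('g free_word \<Rightarrow>\<^sub>0 'k) set" where
  "hom_relations smul g =
     {free_gen (g (x + y)) - free_gen (g x) - free_gen (g y) | x y. True} \<union>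
     {free_gen (g (x * y)) - free_gen (g x) * free_gen (g y) | x y. True} \<union>
     {free_gen (g (smul c x)) - free_const c * free_gen (g x) | c x. True} \<union>
     {free_gen (g 1) - 1}"

definition free_product_ideal :: "('k::comm_ring_1 \<Rightarrow> 'a::ring_1 \<Rightarrow> 'a) \<Rightarrow> ('k \<Rightarrow> 'b::ring_1 \<Rightarrow> 'b) \<Rightarrow>
    (('a + 'b) free_word \<Rightarrow>\<^sub>0 'k) set" where
  "free_product_ideal sA sB =
     Idl\<^bsub>ring_of_type\<^esub> (hom_relations sA Inl \<union> hom_relations sB Inr)"

definition free_product :: "('k::comm_ring_1 \<Rightarrow> 'a::ring_1 \<Rightarrow> 'a) \<Rightarrow> ('k \<Rightarrow> 'b::ring_1 \<Rightarrow> 'b) \<Rightarrow>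
    (('a + 'b) free_word \<Rightarrow>\<^sub>0 'k) set ring" where
  "free_product sA sB =
     ring_of_type Quot free_product_ideal sA sB"

definition fp_class :: "('k::comm_ring_1 \<Rightarrow> 'a::ring_1 \<Rightarrow> 'a) \<Rightarrow> ('k \<Rightarrow> 'b::ring_1 \<Rightarrow> 'b) \<Rightarrow>
    (('a + 'b) free_word \<Rightarrow>\<^sub>0 'k) \<Rightarrow> (('a + 'b) free_word \<Rightarrow>\<^sub>0 'k) set" where
  "fp_class sA sB f = free_product_ideal sA sB +>\<^bsub>ring_of_type\<^esub> f"

definition fp_left :: "('k::comm_ring_1 \<Rightarrow> 'a::ring_1 \<Rightarrow> 'a) \<Rightarrow> ('k \<Rightarrow> 'b::ring_1 \<Rightarrow> 'b) \<Rightarrow> 'a \<Rightarrow>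
    (('a + 'b) free_word \<Rightarrow>\<^sub>0 'k) set" where
  "fp_left sA sB x =
     fp_class sA sB (free_gen (Inl x))"

definition fp_right :: "('k::comm_ring_1 \<Rightarrow> 'a::ring_1 \<Rightarrow> 'a) \<Rightarrow> ('k \<Rightarrow> 'b::ring_1 \<Rightarrow> 'b) \<Rightarrow> 'b \<Rightarrow>
    (('a + 'b) free_word \<Rightarrow>\<^sub>0 'k) set" where
  "fp_right sA sB y =
     fp_class sA sB (free_gen (Inr y))"

text \<open>The polynomial ring in \<open>Q\<close> is \<open>'k poly\<close>, with \<open>Q = [:0, 1:]\<close>. The scalar \<open>\<lambda>\<close> in the
  relation \<open>QrQ - P(r)Q + QP(r) + \<lambda>Qr\<close> acts as the element \<open>\<lambda>1\<close> of \<open>R\<close>.\<close>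

definition URB_ideal :: "('k::comm_ring_1 \<Rightarrow> 'r::ring_1 \<Rightarrow> 'r) \<Rightarrow> ('r \<Rightarrow> 'r) \<Rightarrow> 'k \<Rightarrow>
    (('r + 'k poly) free_word \<Rightarrow>\<^sub>0 'k) set set" where
  "URB_ideal smul P lam =
     (let F = free_product smul smult;
          i = fp_left smul smult;
          Q = fp_right smul smult [:0, 1:]
      in Idl\<^bsub>F\<^esub> {(Q \<otimes>\<^bsub>F\<^esub> i r \<otimes>\<^bsub>F\<^esub> Q \<ominus>\<^bsub>F\<^esub> i (P r) \<otimes>\<^bsub>F\<^esub> Q) \<oplus>\<^bsub>F\<^esub> Q \<otimes>\<^bsub>F\<^esub> i (P r)
                 \<oplus>\<^bsub>F\<^esub> i (smul lam 1) \<otimes>\<^bsub>F\<^esub> Q \<otimes>\<^bsub>F\<^esub> i r | r. True})"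

definition URB :: "('k::comm_ring_1 \<Rightarrow> 'r::ring_1 \<Rightarrow> 'r) \<Rightarrow> ('r \<Rightarrow> 'r) \<Rightarrow> 'k \<Rightarrow>
    (('r + 'k poly) free_word \<Rightarrow>\<^sub>0 'k) set set ring" where
  "URB smul P lam =
     free_product smul smult Quot URB_ideal smul P lam"

definition URB_scalar :: "('k::comm_ring_1 \<Rightarrow> 'r::ring_1 \<Rightarrow> 'r) \<Rightarrow> ('r \<Rightarrow> 'r) \<Rightarrow> 'k \<Rightarrow> 'r \<Rightarrow>
    (('r + 'k poly) free_word \<Rightarrow>\<^sub>0 'k) set set" where
  "URB_scalar smul P lam r =
     URB_ideal smul P lam +>\<^bsub>free_product smul smult\<^esub> fp_left smul smult r"

definition URB_Q :: "('k::comm_ring_1 \<Rightarrow> 'r::ring_1 \<Rightarrow> 'r) \<Rightarrow> ('r \<Rightarrow> 'r) \<Rightarrow> 'k \<Rightarrow>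
    (('r + 'k poly) free_word \<Rightarrow>\<^sub>0 'k) set set" where
  "URB_Q smul P lam =
     URB_ideal smul P lam +>\<^bsub>free_product smul smult\<^esub> fp_right smul smult [:0, 1:]"


section \<open>Laurent series\<close>

text \<open>Formal infinite sums of Laurent series are \<open>has_sum\<close> and \<open>infsum\<close> for the library metric on
  Laurent series, which is the \<open>t\<close>-adic one.\<close>

definition fls_scale :: "'k::comm_ring_1 \<Rightarrow> 'k fls \<Rightarrow> 'k fls" where
  "fls_scale c f = fls_const c * f"

definition pole_part :: "'k::comm_ring_1 fls \<Rightarrow> 'k fls" where
  "pole_part f = f - fps_to_fls (fls_regpart f)"

definition laurent_realization ::
    "('k::comm_ring_1 fls \<times> ('k fls \<times> 'k fls \<Rightarrow>\<^sub>0 int) set) ring" where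
  "laurent_realization = rb_realization fls_scale pole_part (- 1)"


section \<open>The realization is a ring\<close>

lemma frag_extend_plus_fun:
  "frag_extend (\<lambda>x. a x + b x) f = frag_extend a f + frag_extend b f"
  by (simp add: frag_extend_def frag_cmul_distrib2 sum.distrib)

lemma frag_extend_diff_fun:
  "frag_extend (\<lambda>x. a x - b x) f = frag_extend a f - frag_extend b f"
proof -
  have "frag_extend (\<lambda>x. (a x - b x) + b x) f = frag_extend (\<lambda>x. a x - b x) f + frag_extend b f"
    by (rule frag_extend_plus_fun)
  then show ?thesis by simp
qed

lemma frag_induct [case_names zero one diff]:
  assumes "P 0" "\<And>x y. P (frag_of (x, y))" "\<And>a b. P a \<Longrightarrow> P b \<Longrightarrow> P (a - b)"
  shows "P (f :: 'a \<times> 'b \<Rightarrow>\<^sub>0 int)"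
  by (rule frag_induction[of f UNIV]) (use assms in auto)

context k_algebra begin

abbreviation "N \<equiv> tensor_null smul"
abbreviation "cls \<equiv> tensor_class smul"
abbreviation "T \<equiv> tensor_group smul"

lemma N_subgroup: "subgroup N (free_Abelian_group UNIV)"
  unfolding tensor_null_def by (rule group.generate_is_subgroup) auto

lemma N_zero: "0 \<in> N"
  using subgroup.one_closed[OF N_subgroup] by simp

lemma N_add: "f \<in> N \<Longrightarrow> g \<in> N \<Longrightarrow> f + g \<in> N"
  using subgroup.m_closed[OF N_subgroup] by simp

lemma N_uminus: "f \<in> N \<Longrightarrow> - f \<in> N"
  using subgroup.m_inv_closed[OF N_subgroup] by simp

lemma N_diff: "f \<in> N \<Longrightarrow> g \<in> N \<Longrightarrow> f - g \<in> N"
  using N_add[OF _ N_uminus] by fastforce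

lemma N_rels:
  "frag_of (x + y, z) - frag_of (x, z) - frag_of (y, z) \<in> N"
  "frag_of (x, y + z) - frag_of (x, y) - frag_of (x, z) \<in> N"
  "frag_of (smul c x, y) - frag_of (x, smul c y) \<in> N"
  unfolding tensor_null_def by (rule generate.incl; force simp: tensor_relations_def)+

lemma N_induct [consumes 1, case_names zero left right bal diff]:
  assumes "f \<in> N" and z: "Q 0"
    and l: "\<And>x y z. Q (frag_of (x + y, z) - frag_of (x, z) - frag_of (y, z))"
    and r: "\<And>x y z. Q (frag_of (x, y + z) - frag_of (x, y) - frag_of (x, z))"
    and b: "\<And>c x y. Q (frag_of (smul c x, y) - frag_of (x, smul c y))"
    and d: "\<And>f g. Q f \<Longrightarrow> Q g \<Longrightarrow> Q (f - g)"
  shows "Q f"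
proof -
  have m: "Q (- g)" if "Q g" for g using d[OF z that] by simp
  have rel: "Q h" if "h \<in> tensor_relations smul" for h
    using that l r b unfolding tensor_relations_def by blast
  from assms(1) show ?thesis unfolding tensor_null_def
  proof (induction rule: generate.induct)
    case (eng h1 h2)
    then show ?case using d[OF _ m, of h1 h2] by simp
  qed (use z rel m in auto)
qed

lemma mem_cls: "g \<in> cls f \<longleftrightarrow> g - f \<in> N"
proof -
  have "g \<in> cls f \<longleftrightarrow> (\<exists>h\<in>N. g = h + f)"
    by (auto simp: tensor_class_def r_coset_def)
  also have "\<dots> \<longleftrightarrow> g - f \<in> N"
    by (metis add_diff_cancel diff_add_cancel)
  finally show ?thesis .
qed

lemma cls_eq_iff: "cls f = cls g \<longleftrightarrow> f - g \<in> N"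
proof
  assume "cls f = cls g"
  then show "f - g \<in> N" using mem_cls[of f f] mem_cls[of f g] N_zero by auto
next
  assume a: "f - g \<in> N"
  have "h \<in> cls f \<longleftrightarrow> h \<in> cls g" for h
    unfolding mem_cls using N_add[OF _ a, of "h - f"] N_diff[OF _ a, of "h - g"] by auto
  then show "cls f = cls g" by blast
qed

lemma cls_self: "f \<in> cls f" by (simp add: mem_cls N_zero)

lemma carrier_T: "carrier T = range cls"
  by (auto simp: tensor_group_def FactGroup_def RCOSETS_def tensor_class_def)

lemma cls_in_T [simp]: "cls f \<in> carrier T" by (simp add: carrier_T)

lemma one_T: "\<one>\<^bsub>T\<^esub> = cls 0"
  using mem_cls[of _ 0] by (auto simp: tensor_group_def FactGroup_def)

lemma mult_T [simp]: "cls f \<otimes>\<^bsub>T\<^esub> cls g = cls (f + g)"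
proof -
  have "N \<lhd> free_Abelian_group UNIV"
    by (rule comm_group.subgroup_imp_normal) (auto simp: N_subgroup abelian_free_Abelian_group)
  from normal.rcos_sum[OF this, of f g] show ?thesis
    by (simp add: tensor_group_def FactGroup_def tensor_class_def)
qed

lemma rep_lact_simps [simp]:
  "rep_lact r 0 = 0" "rep_lact r (frag_of (x, y)) = frag_of (r * x, y)"
  "rep_lact r (f + g) = rep_lact r f + rep_lact r g"
  "rep_lact r (f - g) = rep_lact r f - rep_lact r g"
  by (simp_all add: rep_lact_def frag_extend_add frag_extend_diff)

lemma rep_ract_simps [simp]:
  "rep_ract 0 r = 0" "rep_ract (frag_of (x, y)) r = frag_of (x, y * r)"
  "rep_ract (f + g) r = rep_ract f r + rep_ract g r"
  "rep_ract (f - g) r = rep_ract f r - rep_ract g r"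
  by (simp_all add: rep_ract_def frag_extend_add frag_extend_diff)

lemma rep_mult_simps [simp]:
  "rep_mult s P l 0 g = 0" "rep_mult s P l f 0 = 0"
  "rep_mult s P l (frag_of (x, y)) (frag_of (z, w)) =
     frag_of (x * P (y * z), w) + frag_of (x, P_tilde s P l (y * z) * w)"
  "rep_mult s P l (f + f') g = rep_mult s P l f g + rep_mult s P l f' g"
  "rep_mult s P l (f - f') g = rep_mult s P l f g - rep_mult s P l f' g"
  "rep_mult s P l f (g + g') = rep_mult s P l f g + rep_mult s P l f g'"
  "rep_mult s P l f (g - g') = rep_mult s P l f g - rep_mult s P l f g'"
  by (simp_all add: rep_mult_def frag_extend_add frag_extend_diff case_prod_unfold
      frag_extend_plus_fun frag_extend_diff_fun frag_extend_eq_0)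

lemma rep_lact_N: "f \<in> N \<Longrightarrow> rep_lact r f \<in> N"
proof (induction rule: N_induct)
  case (bal c x y)
  then show ?case using N_rels(3)[of c "r * x" y] by (simp add: scale_mult_right)
qed (auto simp: N_zero N_diff N_rels distrib_left)

lemma rep_ract_N: "f \<in> N \<Longrightarrow> rep_ract f r \<in> N"
proof (induction rule: N_induct)
  case (bal c x y)
  then show ?case using N_rels(3)[of c x "y * r"] by (simp add: scale_mult_left)
qed (auto simp: N_zero N_diff N_rels distrib_right)

lemma rep_lact_add_N: "rep_lact (r + s) f - (rep_lact r f + rep_lact s f) \<in> N"
proof (induction f rule: frag_induct)
  case (one x y)
  then show ?case using N_rels(1)[of "r * x" "s * x" y] by (simp add: distrib_right diff_diff_eq)
next
  case (diff a b)
  then show ?case using N_diff[OF diff.IH] by (simp add: algebra_simps)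
qed (simp add: N_zero)

lemma rep_ract_add_N: "rep_ract f (r + s) - (rep_ract f r + rep_ract f s) \<in> N"
proof (induction f rule: frag_induct)
  case (one x y)
  then show ?case using N_rels(2)[of x "y * r" "y * s"] by (simp add: distrib_left diff_diff_eq)
next
  case (diff a b)
  then show ?case using N_diff[OF diff.IH] by (simp add: algebra_simps)
qed (simp add: N_zero)

lemma rep_act_assoc:
  "rep_lact (r * s) f = rep_lact r (rep_lact s f)"
  "rep_ract f (r * s) = rep_ract (rep_ract f r) s"
  "rep_ract (rep_lact r f) s = rep_lact r (rep_ract f s)"
  "rep_lact 1 f = f" "rep_ract f 1 = f"
  by (induction f rule: frag_induct; simp add: mult.assoc)+

lemma rep_mult_act:
  "rep_mult sc P l (rep_lact r f) g = rep_lact r (rep_mult sc P l f g)"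
  "rep_mult sc P l (rep_ract f s) g = rep_mult sc P l f (rep_lact s g)"
  "rep_ract (rep_mult sc P l f g) s = rep_mult sc P l f (rep_ract g s)"
proof -
  have 1: "rep_mult sc P l (rep_lact r (frag_of (x, y))) g = rep_lact r (rep_mult sc P l (frag_of (x, y)) g)"
    and 2: "rep_mult sc P l (rep_ract (frag_of (x, y)) s) g = rep_mult sc P l (frag_of (x, y)) (rep_lact s g)"
    and 3: "rep_ract (rep_mult sc P l (frag_of (x, y)) g) s = rep_mult sc P l (frag_of (x, y)) (rep_ract g s)"
    for x y by (induction g rule: frag_induct; simp add: mult.assoc)+
  show "rep_mult sc P l (rep_lact r f) g = rep_lact r (rep_mult sc P l f g)"
    by (induction f rule: frag_induct) (simp_all add: 1 del: rep_lact_simps(2) rep_mult_simps(3))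
  show "rep_mult sc P l (rep_ract f s) g = rep_mult sc P l f (rep_lact s g)"
    by (induction f rule: frag_induct) (simp_all add: 2 del: rep_ract_simps(2) rep_mult_simps(3))
  show "rep_ract (rep_mult sc P l f g) s = rep_mult sc P l f (rep_ract g s)"
    by (induction f rule: frag_induct) (simp_all add: 3 del: rep_ract_simps(2) rep_mult_simps(3))
qed

lemma tensor_lact_cls [simp]: "tensor_lact smul r (cls f) = cls (rep_lact r f)"
proof -
  have "cls (rep_lact r g) = cls (rep_lact r f)" if "g \<in> cls f" for g
    using rep_lact_N[of "g - f" r] that by (simp add: cls_eq_iff mem_cls)
  then show ?thesis using cls_self[of f] unfolding tensor_lact_def by fast
qed

lemma tensor_ract_cls [simp]: "tensor_ract smul (cls f) r = cls (rep_ract f r)"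
proof -
  have "cls (rep_ract g r) = cls (rep_ract f r)" if "g \<in> cls f" for g
    using rep_ract_N[of "g - f" r] that by (simp add: cls_eq_iff mem_cls)
  then show ?thesis using cls_self[of f] unfolding tensor_ract_def by fast
qed

end

context rota_baxter_algebra begin

abbreviation "P' \<equiv> P_tilde smul P lam"
abbreviation "M \<equiv> rep_mult smul P lam"

lemma P_add: "P (x + y) = P x + P y"
  and P_scale: "P (smul c x) = smul c (P x)"
  using P_linear by (auto simp: module_hom_iff)

lemma P'_add: "P' (x + y) = P' x + P' y"
  by (simp add: P_tilde_def P_add scale_right_distrib)

lemma P'_scale: "P' (smul c x) = smul c (P' x)"
  by (simp add: P_tilde_def P_scale scale_right_diff_distrib scale_minus_right mult.commute)

lemma P_P'_expand: "P (P' x * y) = - smul lam (P (x * y)) - P (P x * y)"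
proof -
  have "P (- u) = - P u" "P (u - v) = P u - P v" for u v
    using P_linear module_hom.neg module_hom.diff by blast+
  then show ?thesis
    by (simp add: P_tilde_def left_diff_distrib scale_mult_left P_scale)
qed

lemma P_P'_mult: "P (x * P y) = P x * P y + P (P' x * y)"
  using rota_baxter[of x y] by (simp add: P_P'_expand)

lemma P'_P'_mult: "P' (P' x * y) = P' (x * P y) + P' x * P' y"
proof -
  have "P' (P' x * y) - P' x * P' y = - smul lam (P' x * y) - P (P' x * y) - P' x * P' y"
    by (simp add: P_tilde_def[of _ _ _ "P' x * y"])
  also have "\<dots> = P' x * P y - P (P' x * y)"
    by (simp add: P_tilde_def[of _ _ _ y] right_diff_distrib scale_mult_right)
  also have "\<dots> = P' (x * P y)"
    by (simp add: P_tilde_def left_diff_distrib scale_mult_left P_P'_mult)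
  finally show ?thesis by (simp add: algebra_simps)
qed

lemma rep_mult_N_left: "f \<in> N \<Longrightarrow> M f g \<in> N"
proof (induction g rule: frag_induct)
  case (one z w)
  from one show ?case
  proof (induction rule: N_induct)
    case (left x y z')
    show ?case
      using N_add[OF N_rels(1)[of "x * P (z' * z)" "y * P (z' * z)" w] N_rels(1)[of x y "P' (z' * z) * w"]]
      by (simp add: distrib_right algebra_simps)
  next
    case (right x y z')
    show ?case
      using N_add[OF N_rels(1)[of "x * P (y * z)" "x * P (z' * z)" w] N_rels(2)[of x "P' (y * z) * w" "P' (z' * z) * w"]]
      by (simp add: distrib_right distrib_left P_add P'_add algebra_simps)
  next
    case (bal c x y)
    show ?case
      using N_rels(3)[of c x "P' (y * z) * w"]
      by (simp add: scale_mult_left scale_mult_right P_scale P'_scale algebra_simps)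
  qed (auto simp: N_zero N_diff)
qed (auto simp: N_zero N_diff)

lemma rep_mult_N_right: "g \<in> N \<Longrightarrow> M f g \<in> N"
proof (induction f rule: frag_induct)
  case (one z w)
  from one show ?case
  proof (induction rule: N_induct)
    case (left x y z')
    show ?case
      using N_add[OF N_rels(1)[of "z * P (w * x)" "z * P (w * y)" z'] N_rels(2)[of z "P' (w * x) * z'" "P' (w * y) * z'"]]
      by (simp add: distrib_left distrib_right P_add P'_add algebra_simps)
  next
    case (right x y z')
    show ?case
      using N_add[OF N_rels(2)[of "z * P (w * x)" y z'] N_rels(2)[of z "P' (w * x) * y" "P' (w * x) * z'"]]
      by (simp add: distrib_left distrib_right P_add P'_add algebra_simps)
  next
    case (bal c x y)
    show ?case
      using N_rels(3)[of c "z * P (w * x)" y]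
      by (simp add: scale_mult_left scale_mult_right P_scale P'_scale algebra_simps)
  qed (auto simp: N_zero N_diff)
qed (auto simp: N_zero N_diff)

lemma tensor_mult_cls [simp]: "tensor_mult smul P lam (cls f) (cls g) = cls (M f g)"
proof -
  have "cls (M f' g') = cls (M f g)" if "f' \<in> cls f" "g' \<in> cls g" for f' g'
  proof -
    have "M (f' - f) g' + M f (g' - g) \<in> N"
      using that by (intro N_add rep_mult_N_left rep_mult_N_right) (auto simp: mem_cls)
    then show ?thesis by (simp add: cls_eq_iff)
  qed
  then show ?thesis using cls_self[of f] cls_self[of g] unfolding tensor_mult_def by fast
qed

lemma rep_mult_assoc_N: "M (M f g) h - M f (M g h) \<in> N"
proof -
  have gen: "M (M (frag_of (r1, s1)) (frag_of (r2, s2))) (frag_of (r3, s3))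
      - M (frag_of (r1, s1)) (M (frag_of (r2, s2)) (frag_of (r3, s3))) \<in> N" for r1 s1 r2 s2 r3 s3
  proof -
    define u v where "u = s1 * r2" and "v = s2 * r3"
    have e1: "P (u * P v) = P u * P v + P (P' u * v)" by (rule P_P'_mult)
    have e2: "P' (P' u * v) = P' (u * P v) + P' u * P' v" by (rule P'_P'_mult)
    have "frag_of (r1 * P (u * P v), s3) - frag_of (r1 * (P u * P v), s3) - frag_of (r1 * P (P' u * v), s3) \<in> N"
      using N_rels(1)[of "r1 * (P u * P v)" "r1 * P (P' u * v)" s3] by (simp add: e1 distrib_left)
    moreover have "frag_of (r1, P' (P' u * v) * s3) - frag_of (r1, P' (u * P v) * s3) - frag_of (r1, P' u * P' v * s3) \<in> N"
      using N_rels(2)[of r1 "P' (u * P v) * s3" "P' u * P' v * s3"] by (simp add: e2 distrib_right)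
    ultimately have "(frag_of (r1, P' (P' u * v) * s3) - frag_of (r1, P' (u * P v) * s3) - frag_of (r1, P' u * P' v * s3))
      - (frag_of (r1 * P (u * P v), s3) - frag_of (r1 * (P u * P v), s3) - frag_of (r1 * P (P' u * v), s3)) \<in> N"
      by (rule N_diff[rotated])
    then show ?thesis
      by (simp add: u_def v_def mult.assoc algebra_simps)
  qed
  have g2: "M (M (frag_of (r1, s1)) (frag_of (r2, s2))) h - M (frag_of (r1, s1)) (M (frag_of (r2, s2)) h) \<in> N" for r1 s1 r2 s2
  proof (induction h rule: frag_induct)
    case (diff a b)
    then show ?case using N_diff[OF diff.IH] by (simp add: algebra_simps del: rep_mult_simps(3))
  qed (use gen in \<open>auto simp: N_zero simp del: rep_mult_simps(3)\<close>)
  have g3: "M (M (frag_of (r1, s1)) g) h - M (frag_of (r1, s1)) (M g h) \<in> N" for r1 s1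
  proof (induction g rule: frag_induct)
    case (diff a b)
    then show ?case using N_diff[OF diff.IH] by (simp add: algebra_simps del: rep_mult_simps(3))
  qed (use g2 in \<open>auto simp: N_zero simp del: rep_mult_simps(3)\<close>)
  show ?thesis
  proof (induction f rule: frag_induct)
    case (diff a b)
    then show ?case using N_diff[OF diff.IH] by (simp add: algebra_simps del: rep_mult_simps(3))
  qed (use g3 in \<open>auto simp: N_zero simp del: rep_mult_simps(3)\<close>)
qed

abbreviation "RR \<equiv> rb_realization smul P lam"

lemma realization_simps:
  "carrier RR = UNIV \<times> range cls"
  "(r, cls f) \<otimes>\<^bsub>RR\<^esub> (s, cls g) = (r * s, cls (rep_lact r g + rep_ract f s + M f g))"
  "(r, cls f) \<oplus>\<^bsub>RR\<^esub> (s, cls g) = (r + s, cls (f + g))"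
  "\<one>\<^bsub>RR\<^esub> = (1, cls 0)" "\<zero>\<^bsub>RR\<^esub> = (0, cls 0)"
  by (simp_all add: rb_realization_def carrier_T one_T)

lemma realization_ring: "ring RR"
proof (rule ringI)
  have ex: "\<exists>r f. x = (r, cls f)" if "x \<in> carrier RR" for x
    using that by (auto simp: realization_simps)
  note S = realization_simps(2-5)
  show "abelian_group RR"
  proof (rule abelian_groupI)
    fix x assume "x \<in> carrier RR"
    then obtain r f where x: "x = (r, cls f)" using ex by blast
    show "\<exists>y\<in>carrier RR. y \<oplus>\<^bsub>RR\<^esub> x = \<zero>\<^bsub>RR\<^esub>"
      by (rule bexI[of _ "(- r, cls (- f))"]) (simp_all add: x S realization_simps(1))
  qed (auto simp: realization_simps algebra_simps)
  show "monoid RR"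
    proof (rule monoidI)
    fix x y z assume "x \<in> carrier RR" "y \<in> carrier RR" "z \<in> carrier RR"
    then obtain r f s g t h where x: "x = (r, cls f)" "y = (s, cls g)" "z = (t, cls h)" using ex by metis
    show "x \<otimes>\<^bsub>RR\<^esub> y \<otimes>\<^bsub>RR\<^esub> z = x \<otimes>\<^bsub>RR\<^esub> (y \<otimes>\<^bsub>RR\<^esub> z)"
      using rep_mult_assoc_N[of f g h]
      by (simp add: x S mult.assoc cls_eq_iff rep_act_assoc rep_mult_act algebra_simps)
  next
    fix x y assume "x \<in> carrier RR" "y \<in> carrier RR"
    then show "x \<otimes>\<^bsub>RR\<^esub> y \<in> carrier RR" by (auto simp: realization_simps)
  next
    fix x assume "x \<in> carrier RR"
    then obtain r f where x: "x = (r, cls f)" using ex by blast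
    show "\<one>\<^bsub>RR\<^esub> \<otimes>\<^bsub>RR\<^esub> x = x" "x \<otimes>\<^bsub>RR\<^esub> \<one>\<^bsub>RR\<^esub> = x" by (simp_all add: x S rep_act_assoc)
  qed (simp add: realization_simps)
  fix x y z assume "x \<in> carrier RR" "y \<in> carrier RR" "z \<in> carrier RR"
  then obtain r f s g t h where x: "x = (r, cls f)" "y = (s, cls g)" "z = (t, cls h)" using ex by metis
  show "(x \<oplus>\<^bsub>RR\<^esub> y) \<otimes>\<^bsub>RR\<^esub> z = x \<otimes>\<^bsub>RR\<^esub> z \<oplus>\<^bsub>RR\<^esub> y \<otimes>\<^bsub>RR\<^esub> z"
    using rep_lact_add_N[of r s h] by (simp add: x S cls_eq_iff algebra_simps)
  show "z \<otimes>\<^bsub>RR\<^esub> (x \<oplus>\<^bsub>RR\<^esub> y) = z \<otimes>\<^bsub>RR\<^esub> x \<oplus>\<^bsub>RR\<^esub> z \<otimes>\<^bsub>RR\<^esub> y"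
    using rep_ract_add_N[of h r s] by (simp add: x S cls_eq_iff algebra_simps)
qed

end

context rota_baxter_algebra begin

lemma realization_tensor_mult:
  "rb_tensor smul r1 s1 \<otimes>\<^bsub>rb_realization smul P lam\<^esub> rb_tensor smul r2 s2 =
     rb_tensor smul (r1 * P (s1 * r2)) s2 \<oplus>\<^bsub>rb_realization smul P lam\<^esub>
     rb_tensor smul r1 (P_tilde smul P lam (s1 * r2) * s2)"
proof -
  have "frag_of (0, s2) \<in> N" "frag_of (r1, 0) \<in> N"
    using N_uminus[OF N_rels(1)[of 0 0 s2]] N_uminus[OF N_rels(2)[of r1 0 0]] by simp_all
  from N_add[OF this] show ?thesis
    by (simp add: rb_tensor_def pure_tensor_def realization_simps cls_eq_iff)
qed

end


section \<open>The realization is isomorphic to the ring of Rota-Baxter operators\<close>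

lemma ring_of_type_simps [simp]:
  "carrier ring_of_type = UNIV" "x \<otimes>\<^bsub>ring_of_type\<^esub> y = x * y" "x \<oplus>\<^bsub>ring_of_type\<^esub> y = x + y"
  "\<one>\<^bsub>ring_of_type\<^esub> = 1" "\<zero>\<^bsub>ring_of_type\<^esub> = 0"
  by (simp_all add: ring_of_type_def)

lemma ring_ring_of_type: "ring (ring_of_type :: 'r::ring_1 ring)"
proof (rule ringI)
  show "abelian_group (ring_of_type :: 'r ring)"
  proof (rule abelian_groupI)
    fix x :: 'r
    show "\<exists>y\<in>carrier ring_of_type. y \<oplus>\<^bsub>ring_of_type\<^esub> x = \<zero>\<^bsub>ring_of_type\<^esub>"
      by (rule bexI[of _ "- x"]) simp_all
  qed (simp_all add: algebra_simps)
  show "monoid (ring_of_type :: 'r ring)"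
    by (rule monoidI) (simp_all add: mult.assoc)
qed (simp_all add: algebra_simps)

lemma quot_lift:
  fixes A (structure) and T (structure)
  assumes A: "ring A" and T: "ring T" and h: "h \<in> ring_hom A T" and I: "ideal I A"
    and ker: "\<And>x. x \<in> I \<Longrightarrow> h x = \<zero>\<^bsub>T\<^esub>"
  shows "\<exists>h'\<in>ring_hom (A Quot I) T. \<forall>a\<in>carrier A. h' (I +>\<^bsub>A\<^esub> a) = h a"
proof -
  interpret A: ring A by fact
  interpret T: ring T by fact
  interpret I: ideal I A by fact
  define h' where "h' X = the_elem (h ` X)" for X
  have h': "h' (I +>\<^bsub>A\<^esub> a) = h a" if a: "a \<in> carrier A" for a
  proof -
    have "h x = h a" if "x \<in> I +>\<^bsub>A\<^esub> a" for x
    proof -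
      obtain i where i: "i \<in> I" "x = i \<oplus>\<^bsub>A\<^esub> a" using \<open>x \<in> I +>\<^bsub>A\<^esub> a\<close> by (auto simp: a_r_coset_def')
      then show ?thesis
        using ring_hom_add[OF h, of i a] a ker[of i] ring_hom_closed[OF h a] I.Icarr by simp
    qed
    moreover have "a \<in> I +>\<^bsub>A\<^esub> a" using a by (rule I.a_rcos_self)
    ultimately have "h ` (I +>\<^bsub>A\<^esub> a) = {h a}" by blast
    then show ?thesis by (simp add: h'_def)
  qed
  have car: "\<exists>a\<in>carrier A. X = I +>\<^bsub>A\<^esub> a" if "X \<in> carrier (A Quot I)" for X
    using that by (auto simp: FactRing_simps)
  note hom = I.rcos_ring_hom
  have "h' \<in> ring_hom (A Quot I) T"
  proof (rule ring_hom_memI)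
    fix X assume X: "X \<in> carrier (A Quot I)"
    from car[OF X] obtain a where a: "a \<in> carrier A" "X = I +>\<^bsub>A\<^esub> a" by blast
    show "h' X \<in> carrier T" using a h' ring_hom_closed[OF h] by simp
    fix Y assume Y: "Y \<in> carrier (A Quot I)"
    from car[OF Y] obtain b where b: "b \<in> carrier A" "Y = I +>\<^bsub>A\<^esub> b" by blast
    have "X \<otimes>\<^bsub>A Quot I\<^esub> Y = I +>\<^bsub>A\<^esub> (a \<otimes>\<^bsub>A\<^esub> b)"
      using ring_hom_mult[OF hom a(1) b(1)] a b by simp
    then show "h' (X \<otimes>\<^bsub>A Quot I\<^esub> Y) = h' X \<otimes>\<^bsub>T\<^esub> h' Y"
      using a b h' ring_hom_mult[OF h] by simp
    have "X \<oplus>\<^bsub>A Quot I\<^esub> Y = I +>\<^bsub>A\<^esub> (a \<oplus>\<^bsub>A\<^esub> b)"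
      using ring_hom_add[OF hom a(1) b(1)] a b by simp
    then show "h' (X \<oplus>\<^bsub>A Quot I\<^esub> Y) = h' X \<oplus>\<^bsub>T\<^esub> h' Y"
      using a b h' ring_hom_add[OF h] by simp
  next
    show "h' \<one>\<^bsub>A Quot I\<^esub> = \<one>\<^bsub>T\<^esub>"
      using ring_hom_one[OF hom] h'[of "\<one>\<^bsub>A\<^esub>"] ring_hom_one[OF h] by simp
  qed
  then show ?thesis using h' by blast
qed

lemma genideal_kernel:
  assumes A: "ring A" and T: "ring T" and h: "h \<in> ring_hom A T" and S: "S \<subseteq> carrier A"
    and z: "\<And>x. x \<in> S \<Longrightarrow> h x = \<zero>\<^bsub>T\<^esub>" and x: "x \<in> Idl\<^bsub>A\<^esub> S"
  shows "h x = \<zero>\<^bsub>T\<^esub>"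
proof -
  have hr: "ring_hom_ring A T h" using A T h by (rule ring_hom_ringI2)
  have I: "ideal (a_kernel A T h) A" by (rule ring_hom_ring.kernel_is_ideal[OF hr])
  have "S \<subseteq> a_kernel A T h"
  proof
    fix y assume "y \<in> S"
    then show "y \<in> a_kernel A T h" unfolding a_kernel_def' using S z[of y] by blast
  qed
  then have "Idl\<^bsub>A\<^esub> S \<subseteq> a_kernel A T h" by (rule ring.genideal_minimal[OF A I])
  then show ?thesis using x unfolding a_kernel_def' by blast
qed

lemma poly_mapping_add_induct [case_names zero single add]:
  assumes "P 0" "\<And>k v. P (Poly_Mapping.single k v)" "\<And>f g. P f \<Longrightarrow> P g \<Longrightarrow> P (f + g)"
  shows "P (f :: 'a \<Rightarrow>\<^sub>0 'b::comm_monoid_add)"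
proof (induction f rule: update_induct)
  case (update f a b)
  have "Poly_Mapping.update a b f = f + Poly_Mapping.single a b"
    using update(1)
    by (intro poly_mapping_eqI) (auto simp: lookup_update lookup_add lookup_single in_keys_iff)
  then show ?case using assms update by simp
qed (use assms in auto)

lemma free_single_Cons:
  "Poly_Mapping.single (Word (a # w)) c = free_const c * (free_gen a * Poly_Mapping.single (Word w) 1)"
  by (simp add: free_const_def free_gen_def mult_single zero_free_word_def)

lemma free_algebra_hom_eq:
  fixes h h' :: "('g free_word \<Rightarrow>\<^sub>0 'k::comm_ring_1) \<Rightarrow> 't"
  assumes T: "ring T" and h: "h \<in> ring_hom ring_of_type T" "h' \<in> ring_hom ring_of_type T"
    and g: "\<And>a. h (free_gen a) = h' (free_gen a)" and c: "\<And>c. h (free_const c) = h' (free_const c)"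
  shows "h f = h' f"
proof (induction f rule: poly_mapping_add_induct)
  case zero
  show ?case using ring_hom_zero[OF h(1) ring_ring_of_type T] ring_hom_zero[OF h(2) ring_ring_of_type T] by simp
next
  case (single k v)
  obtain w where k: "k = Word w" by (cases k)
  have "h (Poly_Mapping.single (Word w) v) = h' (Poly_Mapping.single (Word w) v)"
  proof (induction w arbitrary: v)
    case Nil
    then show ?case using c[of v] by (simp add: free_const_def zero_free_word_def)
  next
    case (Cons a w)
    have "x (Poly_Mapping.single (Word (a # w)) v)
        = x (free_const v) \<otimes>\<^bsub>T\<^esub> (x (free_gen a) \<otimes>\<^bsub>T\<^esub> x (Poly_Mapping.single (Word w) 1))"
      if "x \<in> ring_hom ring_of_type T" for x
      unfolding free_single_Cons using ring_hom_mult[OF that] by simp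
    from this[OF h(1)] this[OF h(2)] Cons[of 1] g c show ?case by simp
  qed
  then show ?case by (simp add: k)
next
  case (add f g)
  then show ?case using ring_hom_add[OF h(1), of f g] ring_hom_add[OF h(2), of f g] by simp
qed

lemma free_algebra_hom_exists:
  fixes \<kappa> :: "'k::comm_ring_1 \<Rightarrow> 't" and T (structure)
  assumes T: "ring T" and \<kappa>: "\<kappa> \<in> ring_hom ring_of_type T"
    and central: "\<And>c x. x \<in> carrier T \<Longrightarrow> \<kappa> c \<otimes>\<^bsub>T\<^esub> x = x \<otimes>\<^bsub>T\<^esub> \<kappa> c"
    and \<gamma>: "\<And>a :: 'g. \<gamma> a \<in> carrier T"
  shows "\<exists>h\<in>ring_hom ring_of_type T. (\<forall>c. h (free_const c) = \<kappa> c) \<and> (\<forall>a. h (free_gen a) = \<gamma> a)"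
proof -
  interpret T: ring T by fact
  note [simp] = ring_hom_closed[OF \<kappa>, simplified] \<gamma>
  have \<kappa>0: "\<kappa> 0 = \<zero>\<^bsub>T\<^esub>" using ring_hom_zero[OF \<kappa> ring_ring_of_type T] by simp
  have \<kappa>1: "\<kappa> 1 = \<one>\<^bsub>T\<^esub>" using ring_hom_one[OF \<kappa>] by simp
  have \<kappa>a: "\<kappa> (c + d) = \<kappa> c \<oplus>\<^bsub>T\<^esub> \<kappa> d" and \<kappa>m: "\<kappa> (c * d) = \<kappa> c \<otimes>\<^bsub>T\<^esub> \<kappa> d" for c d
    using ring_hom_add[OF \<kappa>, of c d] ring_hom_mult[OF \<kappa>, of c d] by simp_all
  define ev where "ev w = (case w of Word l \<Rightarrow> foldr (\<lambda>a acc. \<gamma> a \<otimes>\<^bsub>T\<^esub> acc) l \<one>\<^bsub>T\<^esub>)" for w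
  have ev_l: "ev (Word l) \<in> carrier T" for l by (induction l) (simp_all add: ev_def)
  have ev [simp]: "ev w \<in> carrier T" for w using ev_l by (cases w) simp
  have ev0: "ev 0 = \<one>\<^bsub>T\<^esub>" by (simp add: ev_def zero_free_word_def)
  have ev_app: "ev (Word (u @ v)) = ev (Word u) \<otimes>\<^bsub>T\<^esub> ev (Word v)" for u v
  proof (induction u)
    case Nil
    then show ?case using ev_l[of v] by (simp add: ev_def)
  next
    case (Cons a u)
    then show ?case using ev_l[of u] ev_l[of v] by (simp add: ev_def T.m_assoc)
  qed
  have ev_add: "ev (u + v) = ev u \<otimes>\<^bsub>T\<^esub> ev v" for u v
    by (cases u; cases v) (simp add: ev_app)
  define h where "h f = (\<Oplus>\<^bsub>T\<^esub>w\<in>Poly_Mapping.keys f. \<kappa> (Poly_Mapping.lookup f w) \<otimes>\<^bsub>T\<^esub> ev w)"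
    for f :: "'g free_word \<Rightarrow>\<^sub>0 'k"
  have h_sup: "h f = (\<Oplus>\<^bsub>T\<^esub>w\<in>S. \<kappa> (Poly_Mapping.lookup f w) \<otimes>\<^bsub>T\<^esub> ev w)"
    if "finite S" "Poly_Mapping.keys f \<subseteq> S" for f S
    unfolding h_def using that
    by (intro T.add.finprod_mono_neutral_cong_left) (auto simp: in_keys_iff \<kappa>0)
  have h_closed: "h f \<in> carrier T" for f
    unfolding h_def by (rule T.finsum_closed) simp
  have h_add: "h (f + g) = h f \<oplus>\<^bsub>T\<^esub> h g" for f g
  proof -
    let ?S = "Poly_Mapping.keys f \<union> Poly_Mapping.keys g"
    have "h (f + g) = (\<Oplus>\<^bsub>T\<^esub>w\<in>?S. \<kappa> (Poly_Mapping.lookup f w) \<otimes>\<^bsub>T\<^esub> ev w \<oplus>\<^bsub>T\<^esub> \<kappa> (Poly_Mapping.lookup g w) \<otimes>\<^bsub>T\<^esub> ev w)"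
      using Poly_Mapping.keys_add[of f g]
      by (subst h_sup[of ?S]) (auto simp: lookup_add \<kappa>a T.l_distr)
    also have "\<dots> = h f \<oplus>\<^bsub>T\<^esub> h g"
      by (subst T.finsum_addf) (auto simp: h_sup[of ?S, symmetric])
    finally show ?thesis .
  qed
  have h_single: "h (Poly_Mapping.single w c) = \<kappa> c \<otimes>\<^bsub>T\<^esub> ev w" for w c
    by (subst h_sup[of "{w}"]) auto
  have h0: "h 0 = \<zero>\<^bsub>T\<^esub>" by (simp add: h_def)
  have h_mult1: "h (Poly_Mapping.single u c * g) = h (Poly_Mapping.single u c) \<otimes>\<^bsub>T\<^esub> h g" for u c g
  proof (induction g rule: poly_mapping_add_induct)
    case (single v d)
    have "\<kappa> c \<otimes>\<^bsub>T\<^esub> \<kappa> d \<otimes>\<^bsub>T\<^esub> (ev u \<otimes>\<^bsub>T\<^esub> ev v) = \<kappa> c \<otimes>\<^bsub>T\<^esub> (\<kappa> d \<otimes>\<^bsub>T\<^esub> ev u) \<otimes>\<^bsub>T\<^esub> ev v"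
      by (simp add: T.m_assoc)
    also have "\<dots> = \<kappa> c \<otimes>\<^bsub>T\<^esub> (ev u \<otimes>\<^bsub>T\<^esub> \<kappa> d) \<otimes>\<^bsub>T\<^esub> ev v"
      using central[of "ev u" d] by simp
    finally show ?case
      by (simp add: mult_single h_single \<kappa>m ev_add T.m_assoc)
  qed (simp_all add: h0 h_closed h_add distrib_left T.r_distr)
  have h_mult: "h (f * g) = h f \<otimes>\<^bsub>T\<^esub> h g" for f g
    by (induction f rule: poly_mapping_add_induct)
      (simp_all add: h0 h_closed h_add h_mult1 distrib_right T.l_distr)
  have const: "h (free_const c) = \<kappa> c" for c
    by (simp add: free_const_def h_single ev0)
  have "h \<in> ring_hom ring_of_type T"
    using const[of 1]
    by (intro ring_hom_memI) (simp_all add: h_closed h_add h_mult free_const_def \<kappa>1)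
  moreover have "h (free_gen a) = \<gamma> a" for a
    by (simp add: free_gen_def h_single \<kappa>1 ev_def)
  ultimately show ?thesis using const by blast
qed

lemma poly_hom_exists:
  fixes \<kappa> :: "'k::comm_ring_1 \<Rightarrow> 't" and T (structure)
  assumes T: "ring T" and \<kappa>: "\<kappa> \<in> ring_hom ring_of_type T"
    and central: "\<And>c x. x \<in> carrier T \<Longrightarrow> \<kappa> c \<otimes>\<^bsub>T\<^esub> x = x \<otimes>\<^bsub>T\<^esub> \<kappa> c"
    and q: "q \<in> carrier T"
  shows "\<exists>h\<in>ring_hom ring_of_type T. h [:0, 1:] = q \<and> (\<forall>c p. h (smult c p) = \<kappa> c \<otimes>\<^bsub>T\<^esub> h p)"
proof -
  interpret T: ring T by fact
  note [simp] = ring_hom_closed[OF \<kappa>, simplified] q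
  have \<kappa>0: "\<kappa> 0 = \<zero>\<^bsub>T\<^esub>" using ring_hom_zero[OF \<kappa> ring_ring_of_type T] by simp
  have \<kappa>1: "\<kappa> 1 = \<one>\<^bsub>T\<^esub>" using ring_hom_one[OF \<kappa>] by simp
  have \<kappa>a: "\<kappa> (c + d) = \<kappa> c \<oplus>\<^bsub>T\<^esub> \<kappa> d" and \<kappa>m: "\<kappa> (c * d) = \<kappa> c \<otimes>\<^bsub>T\<^esub> \<kappa> d" for c d
    using ring_hom_add[OF \<kappa>, of c d] ring_hom_mult[OF \<kappa>, of c d] by simp_all
  define h where "h p = fold_coeffs (\<lambda>c acc. \<kappa> c \<oplus>\<^bsub>T\<^esub> q \<otimes>\<^bsub>T\<^esub> acc) p \<zero>\<^bsub>T\<^esub>" for p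
  have h0: "h 0 = \<zero>\<^bsub>T\<^esub>" by (simp add: h_def)
  have h_pCons: "h (pCons a p) = \<kappa> a \<oplus>\<^bsub>T\<^esub> q \<otimes>\<^bsub>T\<^esub> h p" for a p
    by (cases "a = 0 \<and> p = 0") (auto simp: h_def \<kappa>0)
  have h_closed [simp]: "h p \<in> carrier T" for p
    by (induction p) (simp_all add: h0 h_pCons)
  have h_add: "h (p + r) = h p \<oplus>\<^bsub>T\<^esub> h r" for p r
  proof (induction p r rule: poly_induct2)
    case (pCons a p b r)
    then show ?case by (simp add: h_pCons \<kappa>a T.r_distr T.a_ac)
  qed (simp add: h0)
  have h_smult: "h (smult c p) = \<kappa> c \<otimes>\<^bsub>T\<^esub> h p" for c p
  proof (induction p)
    case (pCons a p)
    have "q \<otimes>\<^bsub>T\<^esub> (\<kappa> c \<otimes>\<^bsub>T\<^esub> h p) = \<kappa> c \<otimes>\<^bsub>T\<^esub> (q \<otimes>\<^bsub>T\<^esub> h p)"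
      using central[of q c] by (simp add: T.m_assoc[symmetric])
    with pCons show ?case by (simp add: h_pCons \<kappa>m T.r_distr T.m_assoc)
  qed (simp add: h0)
  have h_mult: "h (p * r) = h p \<otimes>\<^bsub>T\<^esub> h r" for p r
  proof (induction p)
    case (pCons a p)
    then show ?case
      by (simp add: h_pCons h_add h_smult \<kappa>0 T.l_distr T.m_assoc)
  qed (simp add: h0)
  have "h 1 = \<one>\<^bsub>T\<^esub>" by (simp add: one_pCons h_pCons h0 \<kappa>1)
  moreover have "h [:0, 1:] = q" by (simp add: h_pCons h0 \<kappa>1 \<kappa>0)
  ultimately show ?thesis
    using h_mult h_add h_smult by (intro bexI[of _ h] ring_hom_memI) auto
qed

lemma hom_diff_zero:
  assumes T: "ring T" and h: "h \<in> ring_hom ring_of_type T" and e: "h x = h y"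
  shows "h (x - y) = \<zero>\<^bsub>T\<^esub>"
proof -
  interpret T: ring T by fact
  have "h (x - y) \<oplus>\<^bsub>T\<^esub> h y = h x" using ring_hom_add[OF h, of "x - y" y] by simp
  then show ?thesis
    using e ring_hom_closed[OF h] by (metis T.add.r_cancel_one UNIV_I ring_of_type_simps(1))
qed

lemma free_product_ideal: "ideal (free_product_ideal sA sB) ring_of_type"
  unfolding free_product_ideal_def by (rule ring.genideal_ideal[OF ring_ring_of_type]) simp

lemma free_product_ring: "ring (free_product sA sB)"
  unfolding free_product_def by (rule ideal.quotient_is_ring[OF free_product_ideal])

lemma fp_class_hom: "fp_class sA sB \<in> ring_hom ring_of_type (free_product sA sB)"
  using ideal.rcos_ring_hom[OF free_product_ideal[of sA sB]] unfolding free_product_def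
  by (simp add: fp_class_def[abs_def])

lemma fp_class_eq:
  assumes "f - g \<in> free_product_ideal sA sB"
  shows "fp_class sA sB f = fp_class sA sB g"
proof -
  interpret I: ideal "free_product_ideal sA sB" ring_of_type by (rule free_product_ideal)
  have "fp_class sA sB f = fp_class sA sB (f - g) \<oplus>\<^bsub>free_product sA sB\<^esub> fp_class sA sB g"
    using ring_hom_add[OF fp_class_hom, of "f - g" g sA sB] by simp
  also have "fp_class sA sB (f - g) = \<zero>\<^bsub>free_product sA sB\<^esub>"
    using assms I.a_rcos_const by (simp add: fp_class_def free_product_def FactRing_def)
  also have "\<zero>\<^bsub>free_product sA sB\<^esub> \<oplus>\<^bsub>free_product sA sB\<^esub> fp_class sA sB g = fp_class sA sB g"
    using ring_hom_closed[OF fp_class_hom, of g sA sB]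
    by (simp add: ring.ring_simprules(8) free_product_ring)
  finally show ?thesis .
qed

lemma fp_class_rel:
  assumes "f - g \<in> hom_relations sA Inl \<union> hom_relations sB Inr"
  shows "fp_class sA sB f = fp_class sA sB g"
proof (rule fp_class_eq)
  show "f - g \<in> free_product_ideal sA sB"
    unfolding free_product_ideal_def
    using ring.genideal_self[OF ring_ring_of_type, of "hom_relations sA Inl \<union> hom_relations sB Inr"] assms
    by auto
qed

lemma fp_gen_rels:
  "fp_class sA sB (free_gen (Inl (x + y))) = fp_class sA sB (free_gen (Inl x) + free_gen (Inl y))"
  "fp_class sA sB (free_gen (Inl (x * y))) = fp_class sA sB (free_gen (Inl x) * free_gen (Inl y))"
  "fp_class sA sB (free_gen (Inl (sA c x))) = fp_class sA sB (free_const c * free_gen (Inl x))"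
  "fp_class sA sB (free_gen (Inl 1)) = fp_class sA sB 1"
  "fp_class sA sB (free_gen (Inr (u + v))) = fp_class sA sB (free_gen (Inr u) + free_gen (Inr v))"
  "fp_class sA sB (free_gen (Inr (u * v))) = fp_class sA sB (free_gen (Inr u) * free_gen (Inr v))"
  "fp_class sA sB (free_gen (Inr (sB c u))) = fp_class sA sB (free_const c * free_gen (Inr u))"
  "fp_class sA sB (free_gen (Inr 1)) = fp_class sA sB 1"
  by (rule fp_class_rel, unfold hom_relations_def diff_diff_eq[symmetric], blast)+

context rota_baxter_algebra begin

abbreviation "FP \<equiv> free_product smul (smult :: 'k \<Rightarrow> 'k poly \<Rightarrow> 'k poly)"
abbreviation "U \<equiv> URB smul P lam"
abbreviation "\<iota> \<equiv> URB_scalar smul P lam"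
abbreviation "q \<equiv> URB_Q smul P lam"
abbreviation "fpc \<equiv> fp_class smul (smult :: 'k \<Rightarrow> 'k poly \<Rightarrow> 'k poly)"

definition "prj f = URB_ideal smul P lam +>\<^bsub>FP\<^esub> fpc f"

lemma fp_gen_class:
  "fp_left smul smult r = fpc (free_gen (Inl r))" "fp_right smul smult p = fpc (free_gen (Inr p))"
  by (simp_all add: fp_left_def fp_right_def fp_class_def)

lemma fpc_closed [simp]: "fpc f \<in> carrier FP"
  using ring_hom_closed[OF fp_class_hom] by simp

lemma URB_gens_closed:
  "{(fpc (free_gen (Inr [:0, 1:])) \<otimes>\<^bsub>FP\<^esub> fpc (free_gen (Inl r)) \<otimes>\<^bsub>FP\<^esub> fpc (free_gen (Inr [:0, 1:]))
      \<ominus>\<^bsub>FP\<^esub> fpc (free_gen (Inl (P r))) \<otimes>\<^bsub>FP\<^esub> fpc (free_gen (Inr [:0, 1:])))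
      \<oplus>\<^bsub>FP\<^esub> fpc (free_gen (Inr [:0, 1:])) \<otimes>\<^bsub>FP\<^esub> fpc (free_gen (Inl (P r)))
      \<oplus>\<^bsub>FP\<^esub> fpc (free_gen (Inl (smul lam 1))) \<otimes>\<^bsub>FP\<^esub> fpc (free_gen (Inr [:0, 1:])) \<otimes>\<^bsub>FP\<^esub> fpc (free_gen (Inl r))
    | r. True} \<subseteq> carrier FP" (is "?S \<subseteq> _")
proof -
  interpret F: ring FP by (rule free_product_ring)
  show ?thesis by auto
qed

lemma URB_ideal: "ideal (URB_ideal smul P lam) FP"
  unfolding URB_ideal_def Let_def fp_gen_class
  by (rule ring.genideal_ideal[OF free_product_ring URB_gens_closed])

lemma U_ring: "ring U"
  unfolding URB_def by (rule ideal.quotient_is_ring[OF URB_ideal])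

lemma U_class_hom: "(+>\<^bsub>FP\<^esub>) (URB_ideal smul P lam) \<in> ring_hom FP U"
  unfolding URB_def by (rule ideal.rcos_ring_hom[OF URB_ideal])

lemma prj_hom: "prj \<in> ring_hom ring_of_type U"
  using ring_hom_trans[OF fp_class_hom U_class_hom] by (simp add: prj_def[abs_def] comp_def)

lemma prj_gen: "prj (free_gen (Inl r)) = \<iota> r" "prj (free_gen (Inr [:0, 1:])) = q"
  by (simp_all add: prj_def URB_scalar_def URB_Q_def fp_gen_class)

lemma prj_simps:
  "prj (f + g) = prj f \<oplus>\<^bsub>U\<^esub> prj g" "prj (f * g) = prj f \<otimes>\<^bsub>U\<^esub> prj g" "prj 1 = \<one>\<^bsub>U\<^esub>" "prj 0 = \<zero>\<^bsub>U\<^esub>"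
  using ring_hom_add[OF prj_hom, of f g] ring_hom_mult[OF prj_hom, of f g] ring_hom_one[OF prj_hom]
    ring_hom_zero[OF prj_hom ring_ring_of_type U_ring] by simp_all

lemma prj_closed [simp]: "prj f \<in> carrier U"
  using ring_hom_closed[OF prj_hom] by simp

lemma iota_closed [simp]: "\<iota> r \<in> carrier U" and q_closed [simp]: "q \<in> carrier U"
  using prj_closed by (metis prj_gen)+

lemma prj_eq: "fpc f = fpc g \<Longrightarrow> prj f = prj g"
  by (simp add: prj_def)

lemma iota_simps:
  "\<iota> (x + y) = \<iota> x \<oplus>\<^bsub>U\<^esub> \<iota> y" "\<iota> (x * y) = \<iota> x \<otimes>\<^bsub>U\<^esub> \<iota> y" "\<iota> 1 = \<one>\<^bsub>U\<^esub>"
  unfolding prj_gen[symmetric] prj_simps[symmetric] by (rule prj_eq, rule fp_gen_rels)+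

lemma iota_hom: "\<iota> \<in> ring_hom ring_of_type U"
  by (rule ring_hom_memI) (simp_all add: iota_simps)

lemma iota_0: "\<iota> 0 = \<zero>\<^bsub>U\<^esub>"
  using ring_hom_zero[OF iota_hom ring_ring_of_type U_ring] by simp

lemma prj_const: "prj (free_const c) = \<iota> (smul c 1)"
proof -
  have "\<iota> (smul c 1) = prj (free_const c * free_gen (Inl 1))"
    unfolding prj_gen[symmetric] by (rule prj_eq, rule fp_gen_rels)
  also have "\<dots> = prj (free_const c) \<otimes>\<^bsub>U\<^esub> \<one>\<^bsub>U\<^esub>"
    by (simp only: prj_simps prj_gen iota_simps)
  finally show ?thesis using monoid.r_one[OF ring.is_monoid[OF U_ring] prj_closed] by simp
qed

lemma free_const_central: "free_const c * f = f * free_const c"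
proof (induction f rule: poly_mapping_add_induct)
  case (single k v)
  then show ?case by (simp add: free_const_def mult_single mult.commute)
qed (simp_all add: algebra_simps)

lemma scalar_q: "\<iota> (smul c 1) \<otimes>\<^bsub>U\<^esub> q = q \<otimes>\<^bsub>U\<^esub> \<iota> (smul c 1)"
  unfolding prj_const[symmetric] prj_gen(2)[symmetric] prj_simps[symmetric] by (simp only: free_const_central)

end

lemma ring_hom_minus:
  fixes A (structure) and T (structure)
  assumes "ring A" "ring T" "h \<in> ring_hom A T" "a \<in> carrier A" "b \<in> carrier A"
  shows "h (a \<ominus>\<^bsub>A\<^esub> b) = h a \<ominus>\<^bsub>T\<^esub> h b"
proof -
  interpret ring_hom_ring A T h using assms(1-3) by (rule ring_hom_ringI2)
  show ?thesis using assms(4,5) by (simp add: a_minus_def)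
qed

context rota_baxter_algebra begin
lemma U_relation:
  "q \<otimes>\<^bsub>U\<^esub> \<iota> r \<otimes>\<^bsub>U\<^esub> q = \<iota> (P r) \<otimes>\<^bsub>U\<^esub> q \<oplus>\<^bsub>U\<^esub> q \<otimes>\<^bsub>U\<^esub> \<iota> (P' r)"
proof -
  interpret U: ring U by (rule U_ring)
  interpret F: ring FP by (rule free_product_ring)
  let ?Q = "fpc (free_gen (Inr [:0, 1:]))" and ?i = "\<lambda>r. fpc (free_gen (Inl r))"
  define c where "c = (+>\<^bsub>FP\<^esub>) (URB_ideal smul P lam)"
  have c: "c \<in> ring_hom FP U" unfolding c_def by (rule U_class_hom)
  define rel where "rel = (?Q \<otimes>\<^bsub>FP\<^esub> ?i r \<otimes>\<^bsub>FP\<^esub> ?Q \<ominus>\<^bsub>FP\<^esub> ?i (P r) \<otimes>\<^bsub>FP\<^esub> ?Q) \<oplus>\<^bsub>FP\<^esub> ?Q \<otimes>\<^bsub>FP\<^esub> ?i (P r)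
      \<oplus>\<^bsub>FP\<^esub> ?i (smul lam 1) \<otimes>\<^bsub>FP\<^esub> ?Q \<otimes>\<^bsub>FP\<^esub> ?i r"
  have "rel \<in> URB_ideal smul P lam"
    unfolding URB_ideal_def Let_def fp_gen_class rel_def
    by (rule subsetD[OF F.genideal_self[OF URB_gens_closed]]) blast
  from abelian_subgroup.a_rcos_const[OF _ this] have "c rel = URB_ideal smul P lam"
    unfolding c_def using ideal.axioms(1)[OF URB_ideal] F.is_abelian_group abelian_subgroupI3 by blast
  also have "\<dots> = \<zero>\<^bsub>U\<^esub>" unfolding URB_def FactRing_def by simp
  finally have c0: "c rel = \<zero>\<^bsub>U\<^esub>" .
  have pr: "c (?i x) = \<iota> x" "c ?Q = q" for x
    unfolding prj_gen[symmetric] prj_def c_def by (rule refl)+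
  have "c rel = (q \<otimes>\<^bsub>U\<^esub> \<iota> r \<otimes>\<^bsub>U\<^esub> q \<ominus>\<^bsub>U\<^esub> \<iota> (P r) \<otimes>\<^bsub>U\<^esub> q) \<oplus>\<^bsub>U\<^esub> q \<otimes>\<^bsub>U\<^esub> \<iota> (P r)
      \<oplus>\<^bsub>U\<^esub> \<iota> (smul lam 1) \<otimes>\<^bsub>U\<^esub> q \<otimes>\<^bsub>U\<^esub> \<iota> r"
    unfolding rel_def
    by (simp only: ring_hom_add[OF c] ring_hom_mult[OF c] ring_hom_minus[OF F.ring_axioms U_ring c] pr
        F.m_closed F.a_closed F.minus_closed fpc_closed)
  with c0 have rel: "(q \<otimes>\<^bsub>U\<^esub> \<iota> r \<otimes>\<^bsub>U\<^esub> q \<ominus>\<^bsub>U\<^esub> \<iota> (P r) \<otimes>\<^bsub>U\<^esub> q) \<oplus>\<^bsub>U\<^esub> q \<otimes>\<^bsub>U\<^esub> \<iota> (P r)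
      \<oplus>\<^bsub>U\<^esub> \<iota> (smul lam 1) \<otimes>\<^bsub>U\<^esub> q \<otimes>\<^bsub>U\<^esub> \<iota> r = \<zero>\<^bsub>U\<^esub>" by simp
  have l: "\<iota> (smul lam 1) \<otimes>\<^bsub>U\<^esub> q \<otimes>\<^bsub>U\<^esub> \<iota> r = q \<otimes>\<^bsub>U\<^esub> \<iota> (smul lam r)"
  proof -
    have "\<iota> (smul lam 1) \<otimes>\<^bsub>U\<^esub> q \<otimes>\<^bsub>U\<^esub> \<iota> r = q \<otimes>\<^bsub>U\<^esub> (\<iota> (smul lam 1) \<otimes>\<^bsub>U\<^esub> \<iota> r)"
      by (simp add: scalar_q U.m_assoc)
    also have "\<iota> (smul lam 1) \<otimes>\<^bsub>U\<^esub> \<iota> r = \<iota> (smul lam r)"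
      by (simp only: iota_simps(2)[symmetric] scale_mult_left mult_1_left)
    finally show ?thesis .
  qed
  have s: "q \<otimes>\<^bsub>U\<^esub> \<iota> (P' r) \<oplus>\<^bsub>U\<^esub> (q \<otimes>\<^bsub>U\<^esub> \<iota> (P r) \<oplus>\<^bsub>U\<^esub> q \<otimes>\<^bsub>U\<^esub> \<iota> (smul lam r)) = \<zero>\<^bsub>U\<^esub>"
  proof -
    have "q \<otimes>\<^bsub>U\<^esub> \<iota> (P' r) \<oplus>\<^bsub>U\<^esub> (q \<otimes>\<^bsub>U\<^esub> \<iota> (P r) \<oplus>\<^bsub>U\<^esub> q \<otimes>\<^bsub>U\<^esub> \<iota> (smul lam r))
      = q \<otimes>\<^bsub>U\<^esub> \<iota> (P' r + (P r + smul lam r))"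
      by (simp add: U.r_distr iota_simps)
    also have "P' r + (P r + smul lam r) = 0" by (simp add: P_tilde_def)
    finally show ?thesis by (simp add: iota_0)
  qed
  define A B C D E where "A = q \<otimes>\<^bsub>U\<^esub> \<iota> r \<otimes>\<^bsub>U\<^esub> q" and "B = \<iota> (P r) \<otimes>\<^bsub>U\<^esub> q" and "C = q \<otimes>\<^bsub>U\<^esub> \<iota> (P r)"
    and "D = q \<otimes>\<^bsub>U\<^esub> \<iota> (smul lam r)" and "E = q \<otimes>\<^bsub>U\<^esub> \<iota> (P' r)"
  have cl: "A \<in> carrier U" "B \<in> carrier U" "C \<in> carrier U" "D \<in> carrier U" "E \<in> carrier U"
    by (simp_all add: A_def B_def C_def D_def E_def)
  have r1: "(A \<ominus>\<^bsub>U\<^esub> B) \<oplus>\<^bsub>U\<^esub> C \<oplus>\<^bsub>U\<^esub> D = \<zero>\<^bsub>U\<^esub>" using rel l by (simp add: A_def B_def C_def D_def)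
  have r2: "E \<oplus>\<^bsub>U\<^esub> (C \<oplus>\<^bsub>U\<^esub> D) = \<zero>\<^bsub>U\<^esub>" using s by (simp add: C_def D_def E_def)
  have "(A \<ominus>\<^bsub>U\<^esub> B) \<oplus>\<^bsub>U\<^esub> (C \<oplus>\<^bsub>U\<^esub> D) = E \<oplus>\<^bsub>U\<^esub> (C \<oplus>\<^bsub>U\<^esub> D)"
    using r1 r2 cl by (simp add: U.a_assoc)
  then have "A \<ominus>\<^bsub>U\<^esub> B = E" using cl by (meson U.add.m_closed U.add.right_cancel U.minus_closed)
  then have "B \<oplus>\<^bsub>U\<^esub> E = A" using cl by (metis U.add.m_comm U.add.inv_solve_right U.add.inv_closed a_minus_def)
  then show ?thesis by (simp add: A_def B_def E_def)
qed

end

context rota_baxter_algebra begin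

lemma iota_central_scalar: "\<iota> (smul c 1) \<otimes>\<^bsub>U\<^esub> \<iota> r = \<iota> r \<otimes>\<^bsub>U\<^esub> \<iota> (smul c 1)"
  unfolding iota_simps(2)[symmetric] by (simp add: scale_mult_left scale_mult_right)

lemma realization_to_URB:
  "\<exists>\<phi>\<in>ring_hom RR U. (\<forall>r. \<phi> (r, cls 0) = \<iota> r) \<and>
     (\<forall>x y. \<phi> (0, cls (frag_of (x, y))) = \<iota> x \<otimes>\<^bsub>U\<^esub> q \<otimes>\<^bsub>U\<^esub> \<iota> y)"
proof -
  interpret U: ring U by (rule U_ring)
  let ?t = "\<lambda>(x, y). \<iota> x \<otimes>\<^bsub>U\<^esub> q \<otimes>\<^bsub>U\<^esub> \<iota> y"
  have cg: "comm_group (add_monoid U)" by (rule U.a_comm_group)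
  have rng: "range ?t \<subseteq> carrier (add_monoid U)" by (rule image_subsetI) (simp add: case_prod_unfold)
  obtain h where hh: "h \<in> hom (free_Abelian_group UNIV) (add_monoid U)"
    and hof: "\<And>p. h (frag_of p) = ?t p"
  proof (rule comm_group.free_Abelian_group_universal[OF cg rng])
    fix h assume "h \<in> hom (free_Abelian_group UNIV) (add_monoid U)" "\<And>p. p \<in> UNIV \<Longrightarrow> h (frag_of p) = ?t p"
    then show thesis by (intro that[of h]) simp_all
  qed
  have hc [simp]: "h f \<in> carrier U" for f
    using hom_in_carrier[OF hh, of f] by simp
  have ha: "h (f + g) = h f \<oplus>\<^bsub>U\<^esub> h g" for f g
    using hom_mult[OF hh, of f g] by simp
  have h0: "h 0 = \<zero>\<^bsub>U\<^esub>"
    using ha[of 0 0] hc[of 0] by (metis U.add.r_cancel_one add_0)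
  have hd: "h (f - g) = h f \<ominus>\<^bsub>U\<^esub> h g" for f g
  proof -
    have "h f = h (f - g) \<oplus>\<^bsub>U\<^esub> h g" using ha[of "f - g" g] by simp
    then show ?thesis by (metis U.add.inv_closed U.add.inv_solve_right a_minus_def hc)
  qed
  have hgen: "h (frag_of (x, y)) = \<iota> x \<otimes>\<^bsub>U\<^esub> q \<otimes>\<^bsub>U\<^esub> \<iota> y" for x y
    by (simp add: hof)
  have minus_eq: "a \<ominus>\<^bsub>U\<^esub> b \<ominus>\<^bsub>U\<^esub> c = \<zero>\<^bsub>U\<^esub>"
    if "a = b \<oplus>\<^bsub>U\<^esub> c" "b \<in> carrier U" "c \<in> carrier U" for a b c
  proof -
    have "a \<ominus>\<^bsub>U\<^esub> b \<ominus>\<^bsub>U\<^esub> c = (b \<oplus>\<^bsub>U\<^esub> c) \<oplus>\<^bsub>U\<^esub> (\<ominus>\<^bsub>U\<^esub> b \<oplus>\<^bsub>U\<^esub> \<ominus>\<^bsub>U\<^esub> c)"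
      unfolding a_minus_def that(1) by (rule U.a_assoc) (simp_all add: that)
    also have "\<ominus>\<^bsub>U\<^esub> b \<oplus>\<^bsub>U\<^esub> \<ominus>\<^bsub>U\<^esub> c = \<ominus>\<^bsub>U\<^esub> (b \<oplus>\<^bsub>U\<^esub> c)"
      using that by (simp add: U.minus_add)
    finally show ?thesis using U.r_neg[of "b \<oplus>\<^bsub>U\<^esub> c"] that by simp
  qed
  have hN: "h f = \<zero>\<^bsub>U\<^esub>" if "f \<in> N" for f
    using that
  proof (induction rule: N_induct)
    case (left x y z)
    show ?case unfolding hd
      by (rule minus_eq) (simp_all add: hgen iota_simps U.l_distr)
  next
    case (right x y z)
    show ?case unfolding hd
      by (rule minus_eq) (simp_all add: hgen iota_simps U.r_distr)
  next
    case (bal c x y)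
    have "smul c x = x * smul c 1" "smul c y = smul c 1 * y"
      by (simp_all add: scale_mult_left scale_mult_right)
    then have "\<iota> (smul c x) \<otimes>\<^bsub>U\<^esub> q \<otimes>\<^bsub>U\<^esub> \<iota> y = \<iota> x \<otimes>\<^bsub>U\<^esub> (\<iota> (smul c 1) \<otimes>\<^bsub>U\<^esub> q) \<otimes>\<^bsub>U\<^esub> \<iota> y"
      by (simp add: iota_simps U.m_assoc)
    also have "\<dots> = \<iota> x \<otimes>\<^bsub>U\<^esub> q \<otimes>\<^bsub>U\<^esub> (\<iota> (smul c 1) \<otimes>\<^bsub>U\<^esub> \<iota> y)"
      unfolding scalar_q by (simp add: U.m_assoc)
    also have "\<dots> = \<iota> x \<otimes>\<^bsub>U\<^esub> q \<otimes>\<^bsub>U\<^esub> \<iota> (smul c y)"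
      by (simp add: iota_simps(2)[symmetric] scale_mult_left)
    finally show ?case unfolding hd hgen by (simp add: a_minus_def U.r_neg)
  next
    case (diff f g)
    then show ?case unfolding hd by (simp add: a_minus_def)
  qed (rule h0)
  have hL: "h (rep_lact r f) = \<iota> r \<otimes>\<^bsub>U\<^esub> h f" for r f
  proof (induction f rule: frag_induct)
    case (one x y)
    then show ?case by (simp add: hgen iota_simps U.m_assoc)
  next
    case (diff a b)
    then show ?case by (simp add: hd a_minus_def U.r_distr U.r_minus)
  qed (simp add: h0)
  have hR: "h (rep_ract f r) = h f \<otimes>\<^bsub>U\<^esub> \<iota> r" for r f
  proof (induction f rule: frag_induct)
    case (one x y)
    then show ?case by (simp add: hgen iota_simps U.m_assoc)
  next
    case (diff a b)
    then show ?case by (simp add: hd a_minus_def U.l_distr U.l_minus)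
  qed (simp add: h0)
  have hM1: "h (M (frag_of (x, y)) g) = h (frag_of (x, y)) \<otimes>\<^bsub>U\<^esub> h g" for x y g
  proof (induction g rule: frag_induct)
    case (one z w)
    have "h (frag_of (x, y)) \<otimes>\<^bsub>U\<^esub> h (frag_of (z, w))
        = \<iota> x \<otimes>\<^bsub>U\<^esub> (q \<otimes>\<^bsub>U\<^esub> (\<iota> y \<otimes>\<^bsub>U\<^esub> \<iota> z) \<otimes>\<^bsub>U\<^esub> q) \<otimes>\<^bsub>U\<^esub> \<iota> w"
      by (simp add: hgen U.m_assoc)
    also have "\<dots> = \<iota> x \<otimes>\<^bsub>U\<^esub> (\<iota> (P (y * z)) \<otimes>\<^bsub>U\<^esub> q \<oplus>\<^bsub>U\<^esub> q \<otimes>\<^bsub>U\<^esub> \<iota> (P' (y * z))) \<otimes>\<^bsub>U\<^esub> \<iota> w"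
      by (simp only: iota_simps(2)[symmetric] U_relation)
    also have "\<dots> = h (M (frag_of (x, y)) (frag_of (z, w)))"
      by (simp add: ha hgen iota_simps(2) U.r_distr U.l_distr U.m_assoc)
    finally show ?case by simp
  next
    case (diff a b)
    then show ?case by (simp add: hd a_minus_def U.r_distr U.r_minus del: rep_mult_simps(3))
  qed (simp add: h0)
  have hM: "h (M f g) = h f \<otimes>\<^bsub>U\<^esub> h g" for f g
  proof (induction f rule: frag_induct)
    case (one x y)
    show ?case by (rule hM1)
  next
    case (diff a b)
    then show ?case by (simp add: hd a_minus_def U.l_distr U.l_minus)
  qed (simp add: h0)
  define \<phi> where "\<phi> = (\<lambda>(r, X). \<iota> r \<oplus>\<^bsub>U\<^esub> h (SOME f. f \<in> X))"
  have \<phi>: "\<phi> (r, cls f) = \<iota> r \<oplus>\<^bsub>U\<^esub> h f" for r f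
  proof -
    have "(SOME g. g \<in> cls f) \<in> cls f" using cls_self by (rule someI)
    then have "h ((SOME g. g \<in> cls f) - f) = \<zero>\<^bsub>U\<^esub>" by (intro hN) (simp add: mem_cls)
    then have "h (SOME g. g \<in> cls f) = h f"
      using ha[of "(SOME g. g \<in> cls f) - f" f] by simp
    then show ?thesis by (simp add: \<phi>_def)
  qed
  have "\<phi> \<in> ring_hom RR U"
  proof (rule ring_hom_memI)
    fix x assume "x \<in> carrier RR"
    then obtain r f where x: "x = (r, cls f)" by (auto simp: realization_simps)
    show "\<phi> x \<in> carrier U" by (simp add: x \<phi>)
    fix y assume "y \<in> carrier RR"
    then obtain s g where y: "y = (s, cls g)" by (auto simp: realization_simps)
    show "\<phi> (x \<oplus>\<^bsub>RR\<^esub> y) = \<phi> x \<oplus>\<^bsub>U\<^esub> \<phi> y"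
      by (simp add: x y realization_simps \<phi> iota_simps ha U.a_ac)
    show "\<phi> (x \<otimes>\<^bsub>RR\<^esub> y) = \<phi> x \<otimes>\<^bsub>U\<^esub> \<phi> y"
      by (simp add: x y realization_simps \<phi> iota_simps ha hL hR hM U.a_ac U.l_distr U.r_distr)
  qed (simp add: realization_simps \<phi> iota_simps h0)
  then show ?thesis by (intro bexI[of _ \<phi>]) (simp_all add: \<phi> h0 iota_0 hgen)
qed

end

context rota_baxter_algebra begin
lemma realization_scalar_hom: "(\<lambda>c. (smul c 1, cls 0)) \<in> ring_hom ring_of_type RR"
  by (rule ring_hom_memI) (simp_all add: realization_simps scale_mult_left scale_left_distrib)

lemma realization_scalar_central:
  assumes "x \<in> carrier RR"
  shows "(smul c 1, cls 0) \<otimes>\<^bsub>RR\<^esub> x = x \<otimes>\<^bsub>RR\<^esub> (smul c 1, cls 0)"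
proof -
  obtain r f where x: "x = (r, cls f)" using assms by (auto simp: realization_simps)
  have "rep_lact (smul c 1) f - rep_ract f (smul c 1) \<in> N"
  proof (induction f rule: frag_induct)
    case (one x y)
    show ?case using N_rels(3)[of c x y] by (simp add: scale_mult_left scale_mult_right)
  next
    case (diff a b)
    then show ?case using N_diff[OF diff.IH] by (simp add: algebra_simps)
  qed (simp add: N_zero)
  moreover have "rep_ract 0 r = 0" "rep_lact r 0 = 0" by simp_all
  ultimately show ?thesis
    by (simp add: x realization_simps cls_eq_iff scale_mult_left scale_mult_right)
qed

lemma P_0: "P 0 = 0" and P'_0: "P' 0 = 0"
  using P_add[of 0 0] P'_add[of 0 0] by simp_all

lemma URB_to_realization:
  "\<exists>\<psi>\<in>ring_hom U RR. (\<forall>r. \<psi> (\<iota> r) = (r, cls 0)) \<and> \<psi> q = (0, cls (frag_of (1, 1)))"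
proof -
  interpret R: ring RR by (rule realization_ring)
  let ?q = "(0, cls (frag_of (1, 1)))"
  let ?\<kappa> = "\<lambda>c. (smul c 1, cls 0)"
  have q: "?q \<in> carrier RR" by (simp add: realization_simps)
  obtain \<beta> where \<beta>: "\<beta> \<in> ring_hom ring_of_type RR" "\<beta> [:0, 1:] = ?q"
    "\<And>c p. \<beta> (smult c p) = ?\<kappa> c \<otimes>\<^bsub>RR\<^esub> \<beta> p"
    using poly_hom_exists[OF realization_ring realization_scalar_hom realization_scalar_central q] by blast
  let ?\<gamma> = "case_sum (\<lambda>r. (r, cls 0)) \<beta>"
  have gc: "?\<gamma> a \<in> carrier RR" for a
    using ring_hom_closed[OF \<beta>(1)] by (cases a) (simp_all add: realization_simps(1))
  have "\<exists>h\<in>ring_hom ring_of_type RR. (\<forall>c. h (free_const c) = ?\<kappa> c) \<and> (\<forall>a. h (free_gen a) = ?\<gamma> a)"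
    by (rule free_algebra_hom_exists[OF realization_ring realization_scalar_hom realization_scalar_central gc])
  then
  obtain h where h: "h \<in> ring_hom ring_of_type RR" "\<And>c. h (free_const c) = ?\<kappa> c"
    "\<And>a. h (free_gen a) = ?\<gamma> a" by blast
  have hm: "h (f * g) = h f \<otimes>\<^bsub>RR\<^esub> h g" and ha: "h (f + g) = h f \<oplus>\<^bsub>RR\<^esub> h g" and h1: "h 1 = \<one>\<^bsub>RR\<^esub>" for f g
    using ring_hom_mult[OF h(1), of f g] ring_hom_add[OF h(1), of f g] ring_hom_one[OF h(1)] by simp_all
  have bm: "\<beta> (f * g) = \<beta> f \<otimes>\<^bsub>RR\<^esub> \<beta> g" and ba: "\<beta> (f + g) = \<beta> f \<oplus>\<^bsub>RR\<^esub> \<beta> g" and b1: "\<beta> 1 = \<one>\<^bsub>RR\<^esub>" for f g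
    using ring_hom_mult[OF \<beta>(1), of f g] ring_hom_add[OF \<beta>(1), of f g] ring_hom_one[OF \<beta>(1)] by simp_all
  have eqs: "h (free_gen (Inl (x + y))) = h (free_gen (Inl x) + free_gen (Inl y))"
    "h (free_gen (Inl (x * y))) = h (free_gen (Inl x) * free_gen (Inl y))"
    "h (free_gen (Inl (smul c x))) = h (free_const c * free_gen (Inl x))"
    "h (free_gen (Inl 1)) = h 1"
    "h (free_gen (Inr (u + v))) = h (free_gen (Inr u) + free_gen (Inr v))"
    "h (free_gen (Inr (u * v))) = h (free_gen (Inr u) * free_gen (Inr v))"
    "h (free_gen (Inr (smult c u))) = h (free_const c * free_gen (Inr u))"
    "h (free_gen (Inr 1)) = h 1" for x y c u v
    by (simp_all add: hm ha h1 h(2,3) bm ba b1 \<beta>(3) realization_simps scale_mult_left)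
  have rel: "h f = \<zero>\<^bsub>RR\<^esub>" if "f \<in> hom_relations smul Inl \<union> hom_relations smult Inr" for f
    using that unfolding hom_relations_def diff_diff_eq
    by (elim UnE CollectE exE conjE singletonE; hypsubst; intro hom_diff_zero[OF realization_ring h(1)] eqs)
  have ker: "h f = \<zero>\<^bsub>RR\<^esub>" if "f \<in> free_product_ideal smul smult" for f
  proof (rule genideal_kernel[OF ring_ring_of_type realization_ring h(1)])
    show "f \<in> Idl\<^bsub>ring_of_type\<^esub> (hom_relations smul Inl \<union> hom_relations smult Inr)"
      using that unfolding free_product_ideal_def .
  qed (simp_all add: rel)
  have "\<exists>h'\<in>ring_hom (ring_of_type Quot free_product_ideal smul smult) RR.
      \<forall>f\<in>carrier ring_of_type. h' (free_product_ideal smul smult +>\<^bsub>ring_of_type\<^esub> f) = h f"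
    by (rule quot_lift[OF ring_ring_of_type realization_ring h(1) free_product_ideal ker])
  then obtain h' where h': "h' \<in> ring_hom FP RR" "\<And>f. h' (fpc f) = h f"
    unfolding free_product_def[symmetric] fp_class_def[symmetric] by auto
  interpret F: ring FP by (rule free_product_ring)
  let ?Q = "fpc (free_gen (Inr [:0, 1:]))" and ?i = "\<lambda>r. fpc (free_gen (Inl r))"
  have gen: "h' ((?Q \<otimes>\<^bsub>FP\<^esub> ?i r \<otimes>\<^bsub>FP\<^esub> ?Q \<ominus>\<^bsub>FP\<^esub> ?i (P r) \<otimes>\<^bsub>FP\<^esub> ?Q) \<oplus>\<^bsub>FP\<^esub> ?Q \<otimes>\<^bsub>FP\<^esub> ?i (P r)
      \<oplus>\<^bsub>FP\<^esub> ?i (smul lam 1) \<otimes>\<^bsub>FP\<^esub> ?Q \<otimes>\<^bsub>FP\<^esub> ?i r) = \<zero>\<^bsub>RR\<^esub>" (is "h' ?rel = _") for r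
  proof -
    have hv: "h' (?i x) = (x, cls 0)" "h' ?Q = ?q" for x
      by (simp_all add: h' h \<beta>(2))
    have minus: "(x, cls f) \<ominus>\<^bsub>RR\<^esub> (y, cls g) = (x - y, cls (f - g))" for x y f g
    proof -
      have "\<ominus>\<^bsub>RR\<^esub> (y, cls g) = (- y, cls (- g))"
        by (rule R.minus_equality) (simp_all add: realization_simps)
      then show ?thesis by (simp add: a_minus_def realization_simps)
    qed
    have "h' ?rel = (?q \<otimes>\<^bsub>RR\<^esub> (r, cls 0) \<otimes>\<^bsub>RR\<^esub> ?q \<ominus>\<^bsub>RR\<^esub> (P r, cls 0) \<otimes>\<^bsub>RR\<^esub> ?q) \<oplus>\<^bsub>RR\<^esub> ?q \<otimes>\<^bsub>RR\<^esub> (P r, cls 0)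
      \<oplus>\<^bsub>RR\<^esub> (smul lam 1, cls 0) \<otimes>\<^bsub>RR\<^esub> ?q \<otimes>\<^bsub>RR\<^esub> (r, cls 0)"
      by (simp only: ring_hom_add[OF h'(1)] ring_hom_mult[OF h'(1)]
          ring_hom_minus[OF F.ring_axioms realization_ring h'(1)] hv
        F.m_closed F.a_closed F.minus_closed fpc_closed)
    also have "\<dots> = (0, cls (frag_of (0, 1) + (frag_of (1, 0) + frag_of (1, P' r)) + frag_of (1, P r) + frag_of (smul lam 1, r)))"
      by (simp add: realization_simps minus P_0 P'_0)
    also have "cls (frag_of (0, 1) + (frag_of (1, 0) + frag_of (1, P' r)) + frag_of (1, P r) + frag_of (smul lam 1, r)) = cls 0"
    proof -
      have 1: "frag_of (smul lam 1, r) - frag_of (1, smul lam r) \<in> N" by (rule N_rels)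
      have 2: "frag_of (1, P' r + P r) - frag_of (1, P' r) - frag_of (1, P r) \<in> N" by (rule N_rels)
      have 3: "frag_of (1, (P' r + P r) + smul lam r) - frag_of (1, P' r + P r) - frag_of (1, smul lam r) \<in> N"
        by (rule N_rels)
      have 4: "frag_of (1, 0 + 0) - frag_of (1, 0) - frag_of (1, 0) \<in> N" by (rule N_rels)
      have 5: "frag_of (0 + 0, 1) - frag_of (0, 1) - frag_of (0, 1) \<in> N" by (rule N_rels)
      have z: "(P' r + P r) + smul lam r = 0" by (simp add: P_tilde_def)
      have "(frag_of (smul lam 1, r) - frag_of (1, smul lam r))
        - (frag_of (1, P' r + P r) - frag_of (1, P' r) - frag_of (1, P r))
        - (frag_of (1, (P' r + P r) + smul lam r) - frag_of (1, P' r + P r) - frag_of (1, smul lam r))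
        - (frag_of (1, 0 + 0) - frag_of (1, 0) - frag_of (1, 0))
        - (frag_of (1, 0 + 0) - frag_of (1, 0) - frag_of (1, 0))
        - (frag_of (0 + 0, 1) - frag_of (0, 1) - frag_of (0, 1)) \<in> N"
        by (intro N_diff 1 2 3 4 5)
      then show ?thesis unfolding z cls_eq_iff by (simp add: algebra_simps)
    qed
    finally show ?thesis by (simp add: realization_simps)
  qed
  have ker2: "h' f = \<zero>\<^bsub>RR\<^esub>" if "f \<in> URB_ideal smul P lam" for f
    by (rule genideal_kernel[OF free_product_ring realization_ring h'(1) URB_gens_closed])
      (use gen that in \<open>unfold URB_ideal_def Let_def fp_gen_class, blast+\<close>)
  have "\<exists>\<psi>\<in>ring_hom (FP Quot URB_ideal smul P lam) RR.
      \<forall>x\<in>carrier FP. \<psi> (URB_ideal smul P lam +>\<^bsub>FP\<^esub> x) = h' x"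
    by (rule quot_lift[OF free_product_ring realization_ring h'(1) URB_ideal ker2])
  then obtain \<psi> where \<psi>0: "\<psi> \<in> ring_hom U RR"
    "\<forall>x\<in>carrier FP. \<psi> (URB_ideal smul P lam +>\<^bsub>FP\<^esub> x) = h' x"
    unfolding URB_def[symmetric] by blast
  have \<psi>: "\<psi> (prj f) = h f" for f
    using \<psi>0(2) h'(2) unfolding prj_def by simp
  show ?thesis
    by (intro bexI[of _ \<psi>] \<psi>0(1)) (simp add: prj_gen[symmetric] \<psi> h \<beta>)
qed

end

lemma quot_carrier_ex: "X \<in> carrier (A Quot I) \<Longrightarrow> \<exists>a\<in>carrier A. X = I +>\<^bsub>A\<^esub> a"
  by (auto simp: FactRing_simps)

context rota_baxter_algebra begin

theorem realization_iso_URB: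
  "\<exists>\<phi>\<in>ring_iso (rb_realization smul P lam) (URB smul P lam).
     (\<forall>r. \<phi> (rb_scalar smul r) = URB_scalar smul P lam r) \<and>
     (\<forall>r s. \<phi> (rb_tensor smul r s) =
        URB_scalar smul P lam r \<otimes>\<^bsub>URB smul P lam\<^esub> URB_Q smul P lam \<otimes>\<^bsub>URB smul P lam\<^esub> URB_scalar smul P lam s)"
proof -
  interpret U: ring U by (rule U_ring)
  interpret R: ring RR by (rule realization_ring)
  obtain \<phi> where \<phi>: "\<phi> \<in> ring_hom RR U" "\<And>r. \<phi> (r, cls 0) = \<iota> r"
     "\<And>x y. \<phi> (0, cls (frag_of (x, y))) = \<iota> x \<otimes>\<^bsub>U\<^esub> q \<otimes>\<^bsub>U\<^esub> \<iota> y"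
    using realization_to_URB by blast
  obtain \<psi> where \<psi>: "\<psi> \<in> ring_hom U RR" "\<And>r. \<psi> (\<iota> r) = (r, cls 0)" "\<psi> q = (0, cls (frag_of (1, 1)))"
    using URB_to_realization by blast
  have \<phi>q: "\<phi> (0, cls (frag_of (1, 1))) = q"
    by (simp add: \<phi>(3) iota_simps)
  have c1: "\<psi> \<circ> \<phi> \<in> ring_hom RR RR" by (rule ring_hom_trans[OF \<phi>(1) \<psi>(1)])
  have tens: "(\<psi> \<circ> \<phi>) (0, cls f) = (0, cls f)" for f
  proof (induction f rule: frag_induct)
    case zero
    show ?case by (simp add: \<phi> \<psi>)
  next
    case (one x y)
    have "\<psi> (\<iota> x \<otimes>\<^bsub>U\<^esub> q \<otimes>\<^bsub>U\<^esub> \<iota> y) = (x, cls 0) \<otimes>\<^bsub>RR\<^esub> (0, cls (frag_of (1, 1))) \<otimes>\<^bsub>RR\<^esub> (y, cls 0)"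
      by (simp add: ring_hom_mult[OF \<psi>(1)] \<psi>)
    then show ?case by (simp add: \<phi> realization_simps)
  next
    case (diff a b)
    let ?d = "(0, cls (a - b))" and ?b = "(0, cls b)" and ?a = "(0, cls a)"
    have cl: "?d \<in> carrier RR" "?b \<in> carrier RR" "?a \<in> carrier RR" by (simp_all add: realization_simps)
    have s: "?d \<oplus>\<^bsub>RR\<^esub> ?b = ?a" by (simp add: realization_simps)
    have "(\<psi> \<circ> \<phi>) ?d \<oplus>\<^bsub>RR\<^esub> ?b = ?d \<oplus>\<^bsub>RR\<^esub> ?b"
      using ring_hom_add[OF c1 cl(1,2)] diff unfolding s by simp
    then show ?case using cl ring_hom_closed[OF c1 cl(1)] by (simp only: R.add.right_cancel)
  qed
  have inv1: "\<psi> (\<phi> x) = x" if xc: "x \<in> carrier RR" for x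
  proof -
    obtain r f where x: "x = (r, cls f)" using xc unfolding realization_simps(1) by blast
    have cl: "(r, cls 0) \<in> carrier RR" "(0, cls f) \<in> carrier RR" by (simp_all add: realization_simps)
    have "x = (r, cls 0) \<oplus>\<^bsub>RR\<^esub> (0, cls f)" by (simp add: x realization_simps)
    then have "(\<psi> \<circ> \<phi>) x = (\<psi> \<circ> \<phi>) (r, cls 0) \<oplus>\<^bsub>RR\<^esub> (\<psi> \<circ> \<phi>) (0, cls f)"
      using ring_hom_add[OF c1 cl] by simp
    also have "\<dots> = (r, cls 0) \<oplus>\<^bsub>RR\<^esub> (0, cls f)" unfolding tens by (simp add: \<phi> \<psi>)
    finally show ?thesis by (simp add: x realization_simps)
  qed
  have c2: "\<phi> \<circ> \<psi> \<in> ring_hom U U" by (rule ring_hom_trans[OF \<psi>(1) \<phi>(1)])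
  have c3: "\<phi> \<circ> \<psi> \<circ> prj \<in> ring_hom ring_of_type U" by (rule ring_hom_trans[OF prj_hom c2])
  have pi: "(\<phi> \<circ> \<psi>) (\<iota> r) = \<iota> r" for r by (simp add: \<psi> \<phi>)
  have pq: "(\<phi> \<circ> \<psi>) q = q" by (simp add: \<psi> \<phi>q)
  have poly: "(\<phi> \<circ> \<psi>) (prj (free_gen (Inr p))) = prj (free_gen (Inr p))" for p
  proof (induction p)
    case 0
    have "prj (free_gen (Inr (smult 0 0))) = prj (free_const 0 * free_gen (Inr 0))"
      by (rule prj_eq) (rule fp_gen_rels)
    then have "prj (free_gen (Inr 0)) = \<zero>\<^bsub>U\<^esub>" by (simp add: prj_simps prj_const iota_0)
    then show ?case using ring_hom_zero[OF c2 U_ring U_ring] by simp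
  next
    case (pCons a p)
    have "pCons a p = smult a 1 + [:0, 1:] * p" by (simp add: one_pCons)
    then have "prj (free_gen (Inr (pCons a p))) = prj (free_gen (Inr (smult a 1)) + free_gen (Inr ([:0, 1:] * p)))"
      by (simp only: prj_eq[OF fp_gen_rels(5)])
    also have "\<dots> = prj (free_const a * free_gen (Inr 1)) \<oplus>\<^bsub>U\<^esub> prj (free_gen (Inr [:0, 1:]) * free_gen (Inr p))"
      by (simp only: prj_simps(1) prj_eq[OF fp_gen_rels(6)] prj_eq[OF fp_gen_rels(7)])
    also have "\<dots> = \<iota> (smul a 1) \<otimes>\<^bsub>U\<^esub> prj 1 \<oplus>\<^bsub>U\<^esub> q \<otimes>\<^bsub>U\<^esub> prj (free_gen (Inr p))"
      by (simp only: prj_simps(2) prj_eq[OF fp_gen_rels(8)] prj_const prj_gen)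
    finally have e: "prj (free_gen (Inr (pCons a p))) = \<iota> (smul a 1) \<oplus>\<^bsub>U\<^esub> q \<otimes>\<^bsub>U\<^esub> prj (free_gen (Inr p))"
      by (simp add: prj_simps)
    show ?case unfolding e
      using pCons.IH
      by (simp only: ring_hom_add[OF c2] ring_hom_mult[OF c2] pi pq iota_closed q_closed prj_closed U.m_closed)
  qed
  have "(\<phi> \<circ> \<psi> \<circ> prj) f = prj f" for f
  proof (rule free_algebra_hom_eq[OF U_ring c3 prj_hom])
    fix a :: "'r + 'k poly"
    show "(\<phi> \<circ> \<psi> \<circ> prj) (free_gen a) = prj (free_gen a)"
      using pi poly by (cases a) (simp_all add: prj_gen)
  next
    fix c
    show "(\<phi> \<circ> \<psi> \<circ> prj) (free_const c) = prj (free_const c)"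
      using pi by (simp add: prj_const)
  qed
  moreover have "\<exists>f. x = prj f" if xc: "x \<in> carrier U" for x
  proof -
    obtain y where "y \<in> carrier FP" "x = URB_ideal smul P lam +>\<^bsub>FP\<^esub> y"
      using xc quot_carrier_ex unfolding URB_def by blast
    moreover from this(1) obtain f where "y = fpc f"
      using quot_carrier_ex unfolding free_product_def fp_class_def by blast
    ultimately show ?thesis unfolding prj_def by blast
  qed
  ultimately have inv2: "\<phi> (\<psi> x) = x" if "x \<in> carrier U" for x using that by fastforce
  have "bij_betw \<phi> (carrier RR) (carrier U)"
    by (rule bij_betw_byWitness[of _ \<psi>])
      (use inv1 inv2 ring_hom_closed[OF \<phi>(1)] ring_hom_closed[OF \<psi>(1)] in auto)
  then have "\<phi> \<in> ring_iso RR U" using \<phi>(1) by (simp add: ring_iso_def)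
  then show ?thesis
    by (intro bexI[of _ \<phi>]) (simp_all add: rb_scalar_def rb_tensor_def pure_tensor_def one_T \<phi>)
qed

end


section \<open>The projection to the pole part is a Rota-Baxter operator\<close>

lemma pole_part_nth [simp]: "fls_nth (pole_part f) n = (if n < 0 then fls_nth f n else 0)"
  by (simp add: pole_part_def)

lemma fps_to_fls_iff: "f \<in> range fps_to_fls \<longleftrightarrow> (\<forall>n<0. fls_nth f n = 0)"
proof
  assume "\<forall>n<0. fls_nth f n = 0"
  then have "f = fps_to_fls (fls_regpart f)" by (intro fls_eqI) auto
  then show "f \<in> range fps_to_fls" by blast
qed auto

lemma pole_part_eq_iff:
  "pole_part f = p \<longleftrightarrow> (\<forall>n\<ge>0. fls_nth p n = 0) \<and> f - p \<in> range fps_to_fls"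
proof
  assume "(\<forall>n\<ge>0. fls_nth p n = 0) \<and> f - p \<in> range fps_to_fls"
  then show "pole_part f = p"
    unfolding fps_to_fls_iff by (intro fls_eqI) (auto simp: not_less)
next
  assume "pole_part f = p"
  then show "(\<forall>n\<ge>0. fls_nth p n = 0) \<and> f - p \<in> range fps_to_fls"
    unfolding fps_to_fls_iff by auto
qed

lemma pole_part_add: "pole_part (f + g) = pole_part f + pole_part g"
  by (intro fls_eqI) simp

lemma k_algebra_fls: "k_algebra (fls_scale :: 'k \<Rightarrow> 'k fls \<Rightarrow> 'k::comm_ring_1 fls)"
proof
  fix c d :: "'k" and f g :: "'k fls"
  show "fls_scale (c + d) f = fls_scale c f + fls_scale d f"
    unfolding fls_scale_def fls_plus_const[symmetric] by (rule distrib_right)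
  show "fls_scale c (fls_scale d f) = fls_scale (c * d) f"
    unfolding fls_scale_def fls_const_mult_const[symmetric] by (rule mult.assoc[symmetric])
qed (simp_all add: fls_scale_def algebra_simps)

lemma rota_baxter_laurent:
  "rota_baxter_algebra (fls_scale :: 'k \<Rightarrow> 'k fls \<Rightarrow> 'k::comm_ring_1 fls) pole_part (- 1)"
proof -
  interpret k_algebra "fls_scale :: 'k \<Rightarrow> 'k fls \<Rightarrow> 'k fls" by (rule k_algebra_fls)
  show ?thesis
  proof (intro rota_baxter_algebra.intro k_algebra_fls rota_baxter_algebra_axioms.intro)
    show "module_hom fls_scale fls_scale (pole_part :: 'k fls \<Rightarrow> 'k fls)"
      unfolding module_hom_iff
      by (auto simp: module_axioms pole_part_add fls_scale_def intro: fls_eqI)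
    fix f g :: "'k fls"
    let ?f = "pole_part f" and ?g = "pole_part g"
    let ?a = "f - ?f" and ?b = "g - ?g"
    have pole: "pole_part (?f * ?g) = ?f * ?g"
    proof (intro fls_eqI)
      fix n :: int
      have "fls_nth (?f * ?g) n = 0" if "n \<ge> 0"
        unfolding fls_times_nth(2) using that by (intro sum.neutral) auto
      then show "fls_nth (pole_part (?f * ?g)) n = fls_nth (?f * ?g) n" by auto
    qed
    obtain u v where "?a = fps_to_fls u" "?b = fps_to_fls v"
      using fps_to_fls_iff[of ?a] fps_to_fls_iff[of ?b] by auto
    then have "?a * ?b = fps_to_fls (u * v)" by (simp add: fls_times_fps_to_fls)
    then have reg: "pole_part (?a * ?b) = 0" by (intro fls_eqI) simp
    have "f * g = ?a * ?b + f * ?g + ?f * g - ?f * ?g" by (simp add: algebra_simps)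
    then have "pole_part (f * g + ?f * ?g) = pole_part (?a * ?b + f * ?g + ?f * g)" by simp
    then have "pole_part (f * g) + ?f * ?g = pole_part (f * ?g) + pole_part (?f * g)"
      by (simp add: pole_part_add pole reg)
    then show "?f * ?g = pole_part (f * ?g) + pole_part (?f * g) + fls_scale (- 1) (pole_part (f * g))"
      by (simp add: fls_scale_def algebra_simps)
  qed
qed

corollary laurent_realization_iso_URB:
  "\<exists>\<phi>\<in>ring_iso laurent_realization (URB fls_scale (pole_part :: 'k::comm_ring_1 fls \<Rightarrow> 'k fls) (- 1)).
     (\<forall>r. \<phi> (rb_scalar fls_scale r) = URB_scalar fls_scale pole_part (- 1) r) \<and>
     (\<forall>r s. \<phi> (rb_tensor fls_scale r s) =
        URB_scalar fls_scale pole_part (- 1) r \<otimes>\<^bsub>URB fls_scale pole_part (- 1)\<^esub> URB_Q fls_scale pole_part (- 1)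
          \<otimes>\<^bsub>URB fls_scale pole_part (- 1)\<^esub> URB_scalar fls_scale pole_part (- 1) s)"
  unfolding laurent_realization_def
  by (rule rota_baxter_algebra.realization_iso_URB[OF rota_baxter_laurent])

end

theory Submission
  imports Defs
begin

text \<open>For weight \<open>-1\<close> the operators \<open>P\<close> and \<open>-\<lambda> id - P\<close> are the two complementary projections, so the
  product formula of the realization splits \<open>b * c\<close> into its pole part and its regular part. It
  remains to recognise these as the \<open>t\<close>-adic sums over \<open>j + k < 0\<close> and \<open>j + k \<ge> 0\<close>, which is checked
  coefficientwise: \<open>t\<close>-adic convergence means that each initial segment of the coefficients is
  eventually constant.\<close>

section \<open>Coefficients of Laurent series and \<open>t\<close>-adic convergence\<close>

lemma fls_monomial_nth:
  "fls_nth (fls_const c * fls_X_intpow i :: 'k::comm_ring_1 fls) n = (if n = i then c else 0)"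
  by simp

text \<open>Lower bounds for the supports can replace the subdegrees in the convolution formula,
  since the extra terms vanish.\<close>

lemma fls_times_nth_bounds:
  fixes f g :: "'k::comm_ring_1 fls"
  assumes f: "\<And>i. i < M \<Longrightarrow> fls_nth f i = 0" and g: "\<And>i. i < N \<Longrightarrow> fls_nth g i = 0"
  shows "fls_nth (f * g) n = (\<Sum>i=M..n - N. fls_nth f i * fls_nth g (n - i))"
\<comment> \<open>The zero series has subdegree 0 by convention, so \<open>M\<close> or
  \<open>N\<close> may exceed it; this case is split off.\<close>
proof (cases "f = 0 \<or> g = 0")
  case True
  then show ?thesis by auto
next
  case False
  then have "M \<le> fls_subdegree f" "N \<le> fls_subdegree g"
    using f g by (auto intro: fls_subdegree_geI)
  then show ?thesis
    unfolding fls_times_nth(2) by (intro sum.mono_neutral_left) (auto simp: not_le)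
qed

text \<open>The distance of distinct series is \<open>2^(-d)\<close>, with \<open>d\<close> the
  subdegree of their difference. The inequality is strict, so it says \<open>n < d\<close>, that is,
  agreement up to and including \<open>n\<close>.\<close>

lemma dist_fls_less_iff:
  fixes f g :: "'a::group_add fls"
  shows "dist f g < inverse (2 ^ n) \<longleftrightarrow> (\<forall>m\<le>int n. fls_nth f m = fls_nth g m)"
proof (cases "f = g")
  case False
  let ?d = "fls_subdegree (f - g)"
  have "dist f g < inverse (2 ^ n) \<longleftrightarrow> int n < ?d"
  proof (cases "?d \<ge> 0")
    case True
    then have "dist f g = inverse (2 ^ nat ?d)" using False by (simp only: dist_fls_def if_True if_False)
    also have "\<dots> < inverse (2 ^ n) \<longleftrightarrow> (2::real) ^ n < 2 ^ nat ?d"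
      by (rule inverse_less_iff_less) simp_all
    also have "\<dots> \<longleftrightarrow> int n < ?d" using True by (simp add: zless_nat_eq_int_zless)
    finally show ?thesis .
  \<comment> \<open>For negative \<open>d\<close> the distance is at least 1, hence never below
    \<open>inverse (2 ^ n)\<close>.\<close>
  next
    case neg: False
    have "inverse (2 ^ n) \<le> (1::real)" "(1::real) \<le> 2 ^ nat (- ?d)"
      by (simp_all add: inverse_le_1_iff)
    then have "\<not> (2::real) ^ nat (- ?d) < inverse (2 ^ n)" by linarith
    then show ?thesis using False neg by (simp add: dist_fls_def)
  qed
  also have "\<dots> \<longleftrightarrow> (\<forall>m\<le>int n. fls_nth (f - g) m = 0)"
  proof
    assume "\<forall>m\<le>int n. fls_nth (f - g) m = 0"
    moreover have "fls_nth (f - g) ?d \<noteq> 0" using False by (intro nth_fls_subdegree_nonzero) simp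
    ultimately show "int n < ?d" by (meson not_le)
  qed (auto intro: fls_eq0_below_subdegree simp del: fls_minus_nth)
  finally show ?thesis by simp
qed (simp add: dist_fls_def)

lemma tendsto_fls_iff:
  fixes f :: "'b \<Rightarrow> 'a::group_add fls"
  shows "(f \<longlongrightarrow> s) F \<longleftrightarrow> (\<forall>n. eventually (\<lambda>x. \<forall>m\<le>n. fls_nth (f x) m = fls_nth s m) F)"
proof
  assume lim: "(f \<longlongrightarrow> s) F"
  show "\<forall>n. eventually (\<lambda>x. \<forall>m\<le>n. fls_nth (f x) m = fls_nth s m) F"
  proof
    fix n :: int
    \<comment> \<open>For negative \<open>n\<close> this uses \<open>nat n = 0\<close>: agreement up
      to exponent 0 is stronger than required.\<close>
    have "eventually (\<lambda>x. dist (f x) s < inverse (2 ^ nat n)) F"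
      using lim by (rule tendstoD) simp
    then show "eventually (\<lambda>x. \<forall>m\<le>n. fls_nth (f x) m = fls_nth s m) F"
      unfolding dist_fls_less_iff by eventually_elim auto
  qed
next
  assume ev: "\<forall>n. eventually (\<lambda>x. \<forall>m\<le>n. fls_nth (f x) m = fls_nth s m) F"
  show "(f \<longlongrightarrow> s) F"
  proof (rule tendstoI)
    fix e :: real assume "e > 0"
    then obtain n where n: "inverse (2 ^ n) < e"
      using real_arch_pow_inv[of e "1/2"] by (auto simp: power_one_over inverse_eq_divide)
    have "eventually (\<lambda>x. dist (f x) s < inverse (2 ^ n)) F"
      using ev unfolding dist_fls_less_iff by blast
    then show "eventually (\<lambda>x. dist (f x) s < e) F"
      by eventually_elim (use n in simp)
  qed
qed

text \<open>Coefficient \<open>m\<close> of a product with \<open>h\<close> depends only on the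
  coefficients of the other factor up to \<open>m - fls_subdegree h\<close>, so a shifted initial
  segment controls it.\<close>

lemma tendsto_fls_mult_right:
  fixes f :: "'b \<Rightarrow> 'k::comm_ring_1 fls"
  assumes "(f \<longlongrightarrow> s) F"
  shows "((\<lambda>x. f x * h) \<longlongrightarrow> s * h) F"
  unfolding tendsto_fls_iff
proof
  fix n
  have "eventually (\<lambda>x. \<forall>m\<le>n - fls_subdegree h. fls_nth (f x) m = fls_nth s m) F"
    using assms unfolding tendsto_fls_iff by blast
  then show "eventually (\<lambda>x. \<forall>m\<le>n. fls_nth (f x * h) m = fls_nth (s * h) m) F"
  proof eventually_elim
    case (elim x)
    have "fls_nth ((f x - s) * h) m = 0" if "m \<le> n" for m
      \<comment> \<open>With this lower bound for the support of \<open>f x - s\<close> the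
        convolution runs over an empty range whenever \<open>m \<le> n\<close>.\<close>
      using fls_times_nth_bounds[of "n - fls_subdegree h + 1" "f x - s" "fls_subdegree h" h m]
        that elim by simp
    then show ?case by (simp add: left_diff_distrib)
  qed
qed

section \<open>\<open>t\<close>-adic sums and their coefficients\<close>

lemma has_sum_fls_mult_right:
  fixes f :: "'b \<Rightarrow> 'k::comm_ring_1 fls"
  assumes "(f has_sum s) A"
  shows "((\<lambda>x. f x * h) has_sum s * h) A"
  using tendsto_fls_mult_right[OF assms[unfolded has_sum_def], of h]
  unfolding has_sum_def sum_distrib_right .

text \<open>All terms outside \<open>X\<close> are invisible up to exponent \<open>n\<close>, so
  every finite set between \<open>X\<close> and \<open>A\<close> has the same partial sum there.
  This is eventual constancy along finite subsets.\<close>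

lemma has_sum_flsI:
  fixes f :: "'b \<Rightarrow> 'k::comm_ring_1 fls"
  assumes "\<And>n. \<exists>X. finite X \<and> X \<subseteq> A \<and> (\<forall>x\<in>A - X. \<forall>m\<le>n. fls_nth (f x) m = 0) \<and>
    (\<forall>m\<le>n. (\<Sum>x\<in>X. fls_nth (f x) m) = fls_nth s m)"
  shows "(f has_sum s) A"
  unfolding has_sum_def tendsto_fls_iff eventually_finite_subsets_at_top
proof
  fix n
  obtain X where X: "finite X" "X \<subseteq> A" "\<And>x m. x \<in> A - X \<Longrightarrow> m \<le> n \<Longrightarrow> fls_nth (f x) m = 0"
    "\<And>m. m \<le> n \<Longrightarrow> (\<Sum>x\<in>X. fls_nth (f x) m) = fls_nth s m"
    using assms[of n] by blast
  have "fls_nth (sum f Y) m = fls_nth s m" if "finite Y" "X \<subseteq> Y" "Y \<subseteq> A" "m \<le> n" for Y m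
  proof -
    have "(\<Sum>x\<in>Y. fls_nth (f x) m) = (\<Sum>x\<in>X. fls_nth (f x) m)"
      using that X(3) by (intro sum.mono_neutral_right) auto
    then show ?thesis using X(4) that by (simp add: fls_nth_sum)
  qed
  then show "\<exists>X. finite X \<and> X \<subseteq> A \<and>
      (\<forall>Y. finite Y \<and> X \<subseteq> Y \<and> Y \<subseteq> A \<longrightarrow> (\<forall>m\<le>n. fls_nth (sum f Y) m = fls_nth s m))"
    by (intro exI[of _ X] conjI allI impI X(1,2)) (elim conjE)
qed

lemma has_sum_fls_monomials_nth:
  fixes a :: "int \<Rightarrow> 'k::comm_ring_1"
  assumes "((\<lambda>i. fls_const (a i) * fls_X_intpow i) has_sum s) A"
  shows "fls_nth s n = (if n \<in> A then a n else 0)"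
proof -
  let ?f = "\<lambda>i. fls_const (a i) * fls_X_intpow i"
  have "eventually (\<lambda>Y. \<forall>m\<le>n. fls_nth (sum ?f Y) m = fls_nth s m) (finite_subsets_at_top A)"
    using assms unfolding has_sum_def tendsto_fls_iff by (rule spec)
  then have "eventually (\<lambda>Y. fls_nth (sum ?f Y) n = fls_nth s n) (finite_subsets_at_top A)"
    by (rule eventually_mono) (drule spec, erule mp, rule order_refl)
  then obtain X where X: "finite X" "X \<subseteq> A"
    "\<forall>Y. finite Y \<and> X \<subseteq> Y \<and> Y \<subseteq> A \<longrightarrow> fls_nth (sum ?f Y) n = fls_nth s n"
    unfolding eventually_finite_subsets_at_top by (elim exE conjE) (rule that)
  \<comment> \<open>Adding \<open>n\<close>, if it lies in \<open>A\<close>, ensures that the finite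
    sum contains the only term that can contribute to coefficient \<open>n\<close>.\<close>
  let ?Y = "X \<union> ({n} \<inter> A)"
  have "fls_nth s n = fls_nth (sum ?f ?Y) n" using X(1,2) by (intro X(3)[rule_format, symmetric]) auto
  also have "\<dots> = (\<Sum>i\<in>?Y. if n = i then a i else 0)"
    unfolding fls_nth_sum by (simp only: fls_monomial_nth)
  also have "\<dots> = (if n \<in> A then a n else 0)" using X(1,2) by (auto simp: sum.delta')
  finally show ?thesis .
qed

text \<open>The predicate \<open>Z\<close> on exponents lets the pole part and the regular part be treated at once.\<close>

lemma has_sum_fls_monomials_product:
  fixes b c :: "int \<Rightarrow> 'k::comm_ring_1"
  assumes B: "((\<lambda>j. fls_const (b j) * fls_X_intpow j) has_sum B) {N..}"
    and C: "((\<lambda>k. fls_const (c k) * fls_X_intpow k) has_sum C) {N..}"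
    and s: "\<And>n. fls_nth s n = (if Z n then fls_nth (B * C) n else 0)"
  shows "((\<lambda>(j, k). fls_const (b j * c k) * fls_X_intpow (j + k)) has_sum s)
    {(j, k). N \<le> j \<and> N \<le> k \<and> Z (j + k)}"
proof (rule has_sum_flsI)
  fix n
  let ?f = "\<lambda>(j, k). fls_const (b j * c k) * fls_X_intpow (j + k) :: 'k fls"
  let ?A = "{(j, k). N \<le> j \<and> N \<le> k \<and> Z (j + k)}"
  let ?X = "{(j, k). N \<le> j \<and> N \<le> k \<and> Z (j + k) \<and> j + k \<le> n}"
  have nth: "fls_nth (?f x) m = (if m = fst x + snd x then b (fst x) * c (snd x) else 0)" for x m
    unfolding case_prod_beta by (rule fls_monomial_nth)
  \<comment> \<open>Each index is at least \<open>N\<close>, so \<open>j + k \<le> n\<close> bounds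
    the other by \<open>n - N\<close>.\<close>
  have "?X \<subseteq> {N..n - N} \<times> {N..n - N}" by auto
  then have fin: "finite ?X" by (rule finite_subset) simp
  have sum: "(\<Sum>x\<in>?X. fls_nth (?f x) m) = fls_nth s m" if m: "m \<le> n" for m
  proof -
    have "(\<Sum>x\<in>?X. fls_nth (?f x) m) = (\<Sum>x\<in>{x\<in>?X. m = fst x + snd x}. b (fst x) * c (snd x))"
      unfolding nth by (rule sum.inter_filter[OF fin, symmetric])
    also have "\<dots> = fls_nth s m"
    \<comment> \<open>\<open>Z\<close> sees only \<open>j + k\<close>, so it keeps or discards the
      diagonal \<open>j + k = m\<close> as a whole. A kept diagonal is the full convolution sum for
      coefficient \<open>m\<close>.\<close>
    proof (cases "Z m")
      case True
      have "(\<Sum>x\<in>{x\<in>?X. m = fst x + snd x}. b (fst x) * c (snd x)) = (\<Sum>j=N..m - N. b j * c (m - j))"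
        by (rule sum.reindex_bij_witness[of _ "\<lambda>j. (j, m - j)" fst]) (use True m in auto)
      also have "\<dots> = (\<Sum>j=N..m - N. fls_nth B j * fls_nth C (m - j))"
        by (intro sum.cong)
          (auto simp: has_sum_fls_monomials_nth[OF B] has_sum_fls_monomials_nth[OF C])
      also have "\<dots> = fls_nth (B * C) m"
        by (intro fls_times_nth_bounds[symmetric])
          (auto simp: has_sum_fls_monomials_nth[OF B] has_sum_fls_monomials_nth[OF C])
      finally show ?thesis using s True by simp
    next
      case False
      then have "{x\<in>?X. m = fst x + snd x} = {}" by auto
      then show ?thesis using s False by (simp only: sum.empty if_False)
    qed
    finally show ?thesis .
  qed
  have "\<forall>x\<in>?A - ?X. \<forall>m\<le>n. fls_nth (?f x) m = 0"
    unfolding nth by auto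
  with fin sum show "\<exists>X. finite X \<and> X \<subseteq> ?A \<and> (\<forall>x\<in>?A - X. \<forall>m\<le>n. fls_nth (?f x) m = 0) \<and>
      (\<forall>m\<le>n. (\<Sum>x\<in>X. fls_nth (?f x) m) = fls_nth s m)"
    by (intro exI[of _ ?X] conjI) (simp_all only: mem_Collect_eq, auto)
qed

section \<open>Products of pure tensors in the realization\<close>

lemma laurent_tensor_mult:
  "rb_tensor fls_scale a b \<otimes>\<^bsub>laurent_realization\<^esub> rb_tensor fls_scale c d =
     rb_tensor fls_scale (a * pole_part (b * c)) d \<oplus>\<^bsub>laurent_realization\<^esub>
     rb_tensor fls_scale a ((b * c - pole_part (b * c)) * d)"
  unfolding laurent_realization_def
    rota_baxter_algebra.realization_tensor_mult[OF rota_baxter_laurent]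
  \<comment> \<open>Weight \<open>-1\<close> turns \<open>P_tilde\<close> into the identity minus
    \<open>pole_part\<close>.\<close>
  by (simp add: P_tilde_def fls_scale_def)

text \<open>Additivity in one factor, applied to \<open>0 + 0\<close>, gives the relation
  \<open>- frag_of (0, d)\<close> or \<open>- frag_of (a, 0)\<close>; its negative is the
  representative itself. This removes the vanishing summand in the monomial case.\<close>

lemma laurent_tensor_zero:
  fixes a d :: "'k::comm_ring_1 fls"
  shows "rb_tensor fls_scale 0 d = \<zero>\<^bsub>laurent_realization\<^esub>"
    and "rb_tensor fls_scale a 0 = \<zero>\<^bsub>laurent_realization\<^esub>"
proof -
  interpret rota_baxter_algebra "fls_scale :: 'k \<Rightarrow> 'k fls \<Rightarrow> 'k fls" pole_part "- 1"
    by (rule rota_baxter_laurent)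
  show "rb_tensor fls_scale 0 d = \<zero>\<^bsub>laurent_realization\<^esub>"
    using N_uminus[OF N_rels(1)[of 0 0 d]]
    by (simp add: laurent_realization_def realization_simps rb_tensor_def pure_tensor_def cls_eq_iff)
  show "rb_tensor fls_scale a 0 = \<zero>\<^bsub>laurent_realization\<^esub>"
    using N_uminus[OF N_rels(2)[of a 0 0]]
    by (simp add: laurent_realization_def realization_simps rb_tensor_def pure_tensor_def cls_eq_iff)
qed

lemma ring_laurent_realization: "ring laurent_realization"
  unfolding laurent_realization_def
  by (rule rota_baxter_algebra.realization_ring[OF rota_baxter_laurent])

lemma rb_tensor_in_laurent: "rb_tensor fls_scale a d \<in> carrier laurent_realization"
  by (simp add: laurent_realization_def rb_realization_def rb_tensor_def pure_tensor_def
      k_algebra.cls_in_T[OF k_algebra_fls])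

lemma laurent_monomial_tensor_mult:
  fixes i j k l :: int
  shows "rb_tensor fls_scale (fls_X_intpow i :: 'k::comm_ring_1 fls) (fls_X_intpow j)
      \<otimes>\<^bsub>laurent_realization\<^esub> rb_tensor fls_scale (fls_X_intpow k) (fls_X_intpow l)
    = (if j + k < 0 then rb_tensor fls_scale (fls_X_intpow (i + j + k)) (fls_X_intpow l)
       else rb_tensor fls_scale (fls_X_intpow i) (fls_X_intpow (j + k + l)))"
proof -
  interpret ring "laurent_realization :: ('k fls \<times> ('k fls \<times> 'k fls \<Rightarrow>\<^sub>0 int) set) ring"
    by (rule ring_laurent_realization)
  have prod: "(fls_X_intpow m :: 'k fls) * fls_X_intpow n = fls_X_intpow (m + n)" for m n
    by (rule fls_X_intpow_times_fls_X_intpow)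
  \<comment> \<open>A monomial is entirely polar or entirely regular, so one of the two tensors in
    the product vanishes.\<close>
  have pole: "pole_part (fls_X_intpow m :: 'k fls) = (if m < 0 then fls_X_intpow m else 0)" for m
    by (intro fls_eqI) auto
  show ?thesis
    unfolding laurent_tensor_mult prod pole
    by (cases "j + k < 0")
      (simp_all only: if_True if_False prod diff_self diff_zero mult_zero_left mult_zero_right
        laurent_tensor_zero rb_tensor_in_laurent l_zero r_zero add.assoc)
qed

lemma laurent_series_tensor_mult:
  fixes a d B C :: "'k::comm_ring_1 fls"
  assumes B: "((\<lambda>j. fls_const (b j) * fls_X_intpow j) has_sum B) {N..}"
    and C: "((\<lambda>k. fls_const (c k) * fls_X_intpow k) has_sum C) {N..}"
  shows "rb_tensor fls_scale a B \<otimes>\<^bsub>laurent_realization\<^esub> rb_tensor fls_scale C d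
    = rb_tensor fls_scale
        (a * (\<Sum>(j, k)\<in>{(j, k). N \<le> j \<and> N \<le> k \<and> j + k < 0}.
           fls_const (b j * c k) * fls_X_intpow (j + k))) d
      \<oplus>\<^bsub>laurent_realization\<^esub>
      rb_tensor fls_scale a
        (\<Sum>\<^sub>\<infinity>(j, k)\<in>{(j, k). N \<le> j \<and> N \<le> k \<and> 0 \<le> j + k}.
           fls_const (b j * c k) * fls_X_intpow (j + k) * d)"
proof -
  let ?f = "\<lambda>(j, k). fls_const (b j * c k) * fls_X_intpow (j + k) :: 'k fls"
  let ?A = "{(j, k). N \<le> j \<and> N \<le> k \<and> j + k < 0}"
  have pole_sum: "(?f has_sum pole_part (B * C)) ?A"
    by (rule has_sum_fls_monomials_product[OF B C, where Z = "\<lambda>n. n < 0"]) (rule pole_part_nth)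
  \<comment> \<open>From \<open>j + k < 0\<close> and \<open>N\<close> as lower bound, both indices
    are at most \<open>- N\<close>; the polar sum is therefore finite. Uniqueness of
    \<open>t\<close>-adic limits then identifies it with \<open>pole_part (B * C)\<close>.\<close>
  have "?A \<subseteq> {N..- N} \<times> {N..- N}" by auto
  then have "finite ?A" by (rule finite_subset) simp
  then have "(?f has_sum sum ?f ?A) ?A" by (rule has_sum_finite)
  from trans[OF infsumI[OF this, symmetric] infsumI[OF pole_sum]]
  have pole: "sum ?f ?A = pole_part (B * C)" .
  have "(?f has_sum B * C - pole_part (B * C)) {(j, k). N \<le> j \<and> N \<le> k \<and> 0 \<le> j + k}"
    by (rule has_sum_fls_monomials_product[OF B C, where Z = "\<lambda>n. 0 \<le> n"]) auto
  \<comment> \<open>The regular sum may be infinite; continuity of multiplication by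
    \<open>d\<close> moves that factor inside it.\<close>
  from infsumI[OF has_sum_fls_mult_right[OF this, of d]]
  have reg: "(\<Sum>\<^sub>\<infinity>(j, k)\<in>{(j, k). N \<le> j \<and> N \<le> k \<and> 0 \<le> j + k}.
      fls_const (b j * c k) * fls_X_intpow (j + k) * d) = (B * C - pole_part (B * C)) * d"
    by (simp only: case_prod_unfold)
  show ?thesis unfolding pole reg by (rule laurent_tensor_mult)
qed

theorem proposition4p11:
  shows
    "(\<forall>i j k l :: int.
        rb_tensor fls_scale (fls_X_intpow i :: 'k::comm_ring_1 fls) (fls_X_intpow j)
          \<otimes>\<^bsub>laurent_realization\<^esub> rb_tensor fls_scale (fls_X_intpow k) (fls_X_intpow l)
        = (if j + k < 0 then rb_tensor fls_scale (fls_X_intpow (i + j + k)) (fls_X_intpow l)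
           else rb_tensor fls_scale (fls_X_intpow i) (fls_X_intpow (j + k + l)))) \<and>
     (\<forall>(N :: int) (a :: int \<Rightarrow> 'k) b c d \<aa> \<bb> \<cc> \<dd>.
        ((\<lambda>i. fls_const (a i) * fls_X_intpow i) has_sum \<aa>) {N..} \<longrightarrow>
        ((\<lambda>j. fls_const (b j) * fls_X_intpow j) has_sum \<bb>) {N..} \<longrightarrow>
        ((\<lambda>k. fls_const (c k) * fls_X_intpow k) has_sum \<cc>) {N..} \<longrightarrow>
        ((\<lambda>l. fls_const (d l) * fls_X_intpow l) has_sum \<dd>) {N..} \<longrightarrow>
        rb_tensor fls_scale \<aa> \<bb> \<otimes>\<^bsub>laurent_realization\<^esub> rb_tensor fls_scale \<cc> \<dd>
        = rb_tensor fls_scale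
            (\<aa> * (\<Sum>(j, k)\<in>{(j, k). N \<le> j \<and> N \<le> k \<and> j + k < 0}.
                     fls_const (b j * c k) * fls_X_intpow (j + k))) \<dd>
          \<oplus>\<^bsub>laurent_realization\<^esub>
          rb_tensor fls_scale \<aa>
            (\<Sum>\<^sub>\<infinity>(j, k)\<in>{(j, k). N \<le> j \<and> N \<le> k \<and> 0 \<le> j + k}.
               fls_const (b j * c k) * fls_X_intpow (j + k) * \<dd>))"
  by (intro conjI allI impI laurent_monomial_tensor_mult laurent_series_tensor_mult)

end
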